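(* Up to isomorphism there is a unique tree with passport $[3^3,1^5;2^7]$, and its monodromy group $G$ satisfies $G\cong A_7\wr\mathbb{Z}_2$.
   Context: A dessin is a connected bicolored (black/white, every edge joining a black and a white vertex) graph with a cyclic (counterclockwise) ordering of the edges around each vertex; here all dessins are finite trees, and an isomorphism is a graph isomorphism preserving colors and cyclic orderings. The passport of a dessin is the pair of lists $[b_1,\dots,b_k;w_1,\dots,w_\ell]$ of degrees of the black vertices and of the white vertices (multisets); within a list, $a^m$ denotes $m$ vertices of degree $a$. Label the edges of a dessin $1,\dots,n$. Let $\sigma_0\in S_n$ (resp. $\sigma_1\in S_n$) be the product of the cycles given by the cyclic orders of the edges around the black (resp. white) vertices. The monodromy group of the dessin is $\langle\sigma_0,\sigma_1\rangle\le S_n$ (independent of the labeling up to conjugacy). For a group $H$, the wreath product $H\wr\mathbb{Z}_2$ is the semidirect product $H^2\rtimes\mathbb{Z}_2$ with $\mathbb{Z}_2$ acting by interchanging the two factors. $A_7$ is the alternating group on $7$ letters. *)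

theory Defs
  imports
    "HOL-Algebra.Sym_Groups"
    "HOL-Algebra.Elementary_Groups"
    "HOL-Combinatorics.Orbits"
    "HOL-Library.Multiset"
begin

section \<open>Bicolored graphs with cyclic orderings\<close>

text \<open>Edges are abstract objects with a black end and a white end;
  \<open>rot D v e\<close> is the edge following \<open>e\<close> in the counterclockwise order around \<open>v\<close>.\<close>

record ('v, 'e) dessin =
  black :: "'v set"
  white :: "'v set"
  edges :: "'e set"
  black_end :: "'e \<Rightarrow> 'v"
  white_end :: "'e \<Rightarrow> 'v"
  rot :: "'v \<Rightarrow> 'e \<Rightarrow> 'e"

definition verts :: "('v, 'e) dessin \<Rightarrow> 'v set" where
  "verts D = black D \<union> white D"

definition ends :: "('v, 'e) dessin \<Rightarrow> 'e \<Rightarrow> 'v set" where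
  "ends D e = {black_end D e, white_end D e}"

definition incident :: "('v, 'e) dessin \<Rightarrow> 'v \<Rightarrow> 'e set" where
  "incident D v = {e \<in> edges D. v \<in> ends D e}"

definition degree :: "('v, 'e) dessin \<Rightarrow> 'v \<Rightarrow> nat" where
  "degree D v = card (incident D v)"

definition adj :: "('v, 'e) dessin \<Rightarrow> ('v \<times> 'v) set" where
  "adj D = {(u, v). \<exists>e\<in>edges D. ends D e = {u, v}}"

definition connected_graph :: "('v, 'e) dessin \<Rightarrow> bool" where
  "connected_graph D \<longleftrightarrow> verts D \<noteq> {} \<and> (\<forall>u\<in>verts D. \<forall>v\<in>verts D. (u, v) \<in> (adj D)\<^sup>*)"

text \<open>\<open>cyclic_on f S\<close> excludes \<open>S = {}\<close>, hence the guard for isolated vertices.\<close>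

definition is_dessin :: "('v, 'e) dessin \<Rightarrow> bool" where
  "is_dessin D \<longleftrightarrow>
     finite (verts D) \<and> finite (edges D) \<and>
     black D \<inter> white D = {} \<and>
     (\<forall>e\<in>edges D. black_end D e \<in> black D \<and> white_end D e \<in> white D) \<and>
     connected_graph D \<and>
     (\<forall>v\<in>verts D. incident D v \<noteq> {} \<longrightarrow> cyclic_on (rot D v) (incident D v))"

text \<open>A cycle visits distinct vertices \<open>vs\<close> along distinct edges \<open>es\<close>.  Length 2 (two parallel
  edges) counts as a cycle; there are no loops, since the two ends of an edge have different colors.\<close>

definition graph_cycle :: "('v, 'e) dessin \<Rightarrow> 'v list \<Rightarrow> 'e list \<Rightarrow> bool" where
  "graph_cycle D vs es \<longleftrightarrow>
     2 \<le> length es \<and> length vs = length es \<and> distinct vs \<and> distinct es \<and>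
     set es \<subseteq> edges D \<and>
     (\<forall>i<length es. ends D (es ! i) = {vs ! i, vs ! (Suc i mod length es)})"

definition is_tree_dessin :: "('v, 'e) dessin \<Rightarrow> bool" where
  "is_tree_dessin D \<longleftrightarrow> is_dessin D \<and> (\<nexists>vs es. graph_cycle D vs es)"

definition passport :: "('v, 'e) dessin \<Rightarrow> nat multiset \<times> nat multiset" where
  "passport D =
     (image_mset (degree D) (mset_set (black D)), image_mset (degree D) (mset_set (white D)))"

definition dessin_isomorphic :: "('v, 'e) dessin \<Rightarrow> ('w, 'f) dessin \<Rightarrow> bool" where
  "dessin_isomorphic D D' \<longleftrightarrow>
     (\<exists>f g. bij_betw f (black D) (black D') \<and> bij_betw f (white D) (white D') \<and>
        bij_betw g (edges D) (edges D') \<and>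
        (\<forall>e\<in>edges D. black_end D' (g e) = f (black_end D e) \<and>
                     white_end D' (g e) = f (white_end D e)) \<and>
        (\<forall>v\<in>verts D. \<forall>e\<in>incident D v. g (rot D v e) = rot D' (f v) (g e)))"


section \<open>Monodromy group\<close>

definition edge_labeling :: "('v, 'e) dessin \<Rightarrow> ('e \<Rightarrow> nat) \<Rightarrow> bool" where
  "edge_labeling D lab \<longleftrightarrow> bij_betw lab (edges D) {1..card (edges D)}"

text \<open>Every edge lies in exactly one of the cycles around the black vertices, namely the one at its
  black end; so the product of these (disjoint) cycles maps an edge to its successor around its black
  end.  Similarly for white.\<close>

definition sigma0 :: "('v, 'e) dessin \<Rightarrow> ('e \<Rightarrow> nat) \<Rightarrow> nat \<Rightarrow> nat" where
  "sigma0 D lab i =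
     (if i \<in> {1..card (edges D)}
      then let e = inv_into (edges D) lab i in lab (rot D (black_end D e) e)
      else i)"

definition sigma1 :: "('v, 'e) dessin \<Rightarrow> ('e \<Rightarrow> nat) \<Rightarrow> nat \<Rightarrow> nat" where
  "sigma1 D lab i =
     (if i \<in> {1..card (edges D)}
      then let e = inv_into (edges D) lab i in lab (rot D (white_end D e) e)
      else i)"

definition monodromy_group :: "('v, 'e) dessin \<Rightarrow> ('e \<Rightarrow> nat) \<Rightarrow> (nat \<Rightarrow> nat) monoid" where
  "monodromy_group D lab =
     (sym_group (card (edges D)))
       \<lparr>carrier := generate (sym_group (card (edges D))) {sigma0 D lab, sigma1 D lab}\<rparr>"


section \<open>Wreath product with the cyclic group of order two\<close>

definition semidirect_product ::
  "('a, 'm) monoid_scheme \<Rightarrow> ('b, 'n) monoid_scheme \<Rightarrow> ('b \<Rightarrow> 'a \<Rightarrow> 'a) \<Rightarrow> ('a \<times> 'b) monoid" where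
  "semidirect_product N K \<phi> =
     \<lparr>carrier = carrier N \<times> carrier K,
      mult = (\<lambda>(x, k) (y, l). (x \<otimes>\<^bsub>N\<^esub> \<phi> k y, k \<otimes>\<^bsub>K\<^esub> l)),
      one = (\<one>\<^bsub>N\<^esub>, \<one>\<^bsub>K\<^esub>)\<rparr>"

definition swap_action :: "int \<Rightarrow> 'a \<times> 'a \<Rightarrow> 'a \<times> 'a" where
  "swap_action k p = (if k = 0 then p else prod.swap p)"

definition wreath_Z2 :: "('a, 'm) monoid_scheme \<Rightarrow> (('a \<times> 'a) \<times> int) monoid" where
  "wreath_Z2 H = semidirect_product (H \<times>\<times> H) (integer_mod_group 2) swap_action"

end

theory Submission
  imports Defs
begin

text \<open>
  A dessin all of whose white vertices have degree two amounts to a graph on the black vertices, with a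
  cyclic order of the edge germs at each of them; the white vertices mark the midpoints of its edges.
  For the passport \<open>[3\<^sup>3, 1\<^sup>5; 2\<^sup>7]\<close> the dessin has 14 edges, and
  writing \<open>s0\<close>, \<open>s1\<close> for the rotations of the edges at their black and white ends, \<open>s1\<close> is a
  fixed-point-free involution.  By connectedness, a nonempty set of edges closed under \<open>s0\<close> and \<open>s1\<close>
  consists of all 14 edges (\<open>monodromy_transitive\<close>).  Hence \<open>s1\<close> never pairs two of the five
  edges at black leaves, so exactly four of the nine edges at trivalent black vertices
  (the bridges) are paired among themselves, and every trivalent vertex has a
  bridge leaving it.  The three trivalent vertices therefore form a path.  Orienting the path by the
  rotation at its middle vertex gives a numbering of the edges by \<open>1, \<dots>, 14\<close> in which both
  rotations are explicit permutations (\<open>normal_form\<close>): \<open>s1\<close> is \<open>i \<leftrightarrow> i + 7\<close>, and \<open>s0\<close> acts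
  as \<open>a = (1 2 3)(4 5 6)\<close> on the first seven numbers and as a shifted copy of \<open>b = (1 4 7)\<close> on
  the last seven.  Uniqueness of the dessin is immediate from this normal form; its existence is
  checked on an explicit tree.

  The normal form also identifies the monodromy group with the subgroup of the wreath product of
  \<open>A\<^sub>7\<close> with the group of order two that is generated by \<open>(a, b)\<close> and the swap.  This subgroup is
  everything (\<open>wreath_A7_generated\<close>).  It contains \<open>(a, b)\<close> and \<open>(b, a)\<close>, and a word in
  these two is a 3-cycle in the first coordinate and trivial in the second.  The permutations \<open>p\<close>
  with \<open>(p, id)\<close> in the subgroup are closed under composition and under conjugation by
  \<open>a\<close> and \<open>b\<close>; conjugating that 3-cycle by these and by the 3-cycles found on the way yields
  all 3-cycles.  They generate \<open>A\<^sub>7\<close>, so the subgroup contains \<open>A\<^sub>7 \<times> 1\<close>, by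
  swapping also \<open>1 \<times> A\<^sub>7\<close>, and hence the whole wreath product.
\<close>

section \<open>The wreath product as a permutation group\<close>

lemma wreath_Z2_simps:
  "carrier (wreath_Z2 H) = (carrier H \<times> carrier H) \<times> {0, 1}"
  "((p, q), k) \<otimes>\<^bsub>wreath_Z2 H\<^esub> ((p', q'), l) =
     (if k = 0 then (p \<otimes>\<^bsub>H\<^esub> p', q \<otimes>\<^bsub>H\<^esub> q') else (p \<otimes>\<^bsub>H\<^esub> q', q \<otimes>\<^bsub>H\<^esub> p'), (k + l) mod 2)"
  "\<one>\<^bsub>wreath_Z2 H\<^esub> = ((\<one>\<^bsub>H\<^esub>, \<one>\<^bsub>H\<^esub>), 0)"
  by (auto simp: wreath_Z2_def semidirect_product_def swap_action_def carrier_integer_mod_group)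

lemma group_wreath_Z2:
  assumes "group H"
  shows "group (wreath_Z2 H)"
proof -
  interpret H: group H by fact
  show ?thesis
  proof (rule groupI)
    fix x assume "x \<in> carrier (wreath_Z2 H)"
    then obtain p q k where x: "x = ((p, q), k)" "p \<in> carrier H" "q \<in> carrier H" "k = 0 \<or> k = 1"
      by (auto simp: wreath_Z2_simps)
    let ?y = "(if k = 0 then (inv\<^bsub>H\<^esub> p, inv\<^bsub>H\<^esub> q) else (inv\<^bsub>H\<^esub> q, inv\<^bsub>H\<^esub> p), k)"
    have "?y \<in> carrier (wreath_Z2 H)" "?y \<otimes>\<^bsub>wreath_Z2 H\<^esub> x = \<one>\<^bsub>wreath_Z2 H\<^esub>"
      using x by (auto simp: wreath_Z2_simps)
    then show "\<exists>y\<in>carrier (wreath_Z2 H). y \<otimes>\<^bsub>wreath_Z2 H\<^esub> x = \<one>\<^bsub>wreath_Z2 H\<^esub>"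
      by blast
  qed (auto simp: wreath_Z2_simps H.m_assoc)
qed

text \<open>The permutation of \<open>{1..2 * n}\<close> that acts as \<open>p\<close> on the block \<open>{1..n}\<close> and as \<open>q\<close>,
  shifted by \<open>n\<close>, on the block \<open>{n + 1..2 * n}\<close>; it is the identity elsewhere, as required by
  \<open>sym_group\<close>.\<close>

definition blocks :: "nat \<Rightarrow> (nat \<Rightarrow> nat) \<Rightarrow> (nat \<Rightarrow> nat) \<Rightarrow> nat \<Rightarrow> nat" where
  "blocks n p q i = (if i \<in> {1..n} then p i else if i \<in> {n + 1..2 * n} then q (i - n) + n else i)"

text \<open>The exchange of the two blocks.\<close>

definition flip :: "nat \<Rightarrow> nat \<Rightarrow> nat" where
  "flip n i = (if i \<in> {1..n} then i + n else if i \<in> {n + 1..2 * n} then i - n else i)"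

text \<open>The imprimitive action of the wreath product on \<open>{1..2 * n}\<close>: the pair acts blockwise, after
  the blocks have been exchanged if the \<open>\<int>\<^sub>2\<close>-component is nonzero.\<close>

definition wreath_perm :: "nat \<Rightarrow> ((nat \<Rightarrow> nat) \<times> (nat \<Rightarrow> nat)) \<times> int \<Rightarrow> nat \<Rightarrow> nat" where
  "wreath_perm n = (\<lambda>((p, q), k). blocks n p q \<circ> (if k = 0 then id else flip n))"

lemma flip_flip: "flip n \<circ> flip n = id"
  by (auto simp: flip_def fun_eq_iff)

lemma permutes_of_inverse:
  assumes "g \<circ> f = id" "f \<circ> g = id" "\<And>x. x \<notin> S \<Longrightarrow> f x = x"
  shows "f permutes S"
  using o_bij[OF assms(1,2)] assms(3) by (simp add: permutes_def bij_iff)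

lemma flip_permutes: "flip n permutes {1..2 * n}"
  by (rule permutes_of_inverse[of "flip n"]) (auto simp: flip_flip flip_def)

lemma two_blocks_cases:
  fixes i n :: nat
  obtains "i \<in> {1..n}" | j where "i = j + n" "j \<in> {1..n}" | "i \<notin> {1..2 * n}"
proof -
  have "i = (i - n) + n \<and> i - n \<in> {1..n}" if "i \<in> {1..2 * n}" "i \<notin> {1..n}"
    using that by auto
  then show thesis using that by blast
qed

lemma blocks_apply:
  "i \<in> {1..n} \<Longrightarrow> blocks n p q i = p i"
  "i \<in> {1..n} \<Longrightarrow> blocks n p q (i + n) = q i + n"
  "i \<notin> {1..2 * n} \<Longrightarrow> blocks n p q i = i"
  by (auto simp: blocks_def)

lemma flip_apply:
  "i \<in> {1..n} \<Longrightarrow> flip n i = i + n"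
  "i \<in> {1..n} \<Longrightarrow> flip n (i + n) = i"
  "i \<notin> {1..2 * n} \<Longrightarrow> flip n i = i"
  by (auto simp: flip_def)

lemma blocks_comp:
  assumes "p permutes {1..n}" "q permutes {1..n}" "p' permutes {1..n}" "q' permutes {1..n}"
  shows "blocks n p q \<circ> blocks n p' q' = blocks n (p \<circ> p') (q \<circ> q')"
proof
  fix i
  consider "i \<in> {1..n}" | j where "i = j + n" "j \<in> {1..n}" | "i \<notin> {1..2 * n}"
    by (rule two_blocks_cases)
  then show "(blocks n p q \<circ> blocks n p' q') i = blocks n (p \<circ> p') (q \<circ> q') i"
  proof cases
    case 1
    then show ?thesis using permutes_in_image[OF assms(3), of i] by (simp add: blocks_apply del: atLeastAtMost_iff)
  next
    case 2
    then show ?thesis using permutes_in_image[OF assms(4), of j] by (simp add: blocks_apply del: atLeastAtMost_iff)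
  next
    case 3
    then show ?thesis by (simp add: blocks_apply del: atLeastAtMost_iff)
  qed
qed

lemma blocks_id: "blocks n id id = id"
  by (auto simp: blocks_def)

lemma blocks_permutes:
  assumes "p permutes {1..n}" "q permutes {1..n}"
  shows "blocks n p q permutes {1..2 * n}"
proof (rule permutes_of_inverse)
  note inv = assms[THEN permutes_inv]
  show "blocks n (inv' p) (inv' q) \<circ> blocks n p q = id" "blocks n p q \<circ> blocks n (inv' p) (inv' q) = id"
    using blocks_comp[OF inv assms] blocks_comp[OF assms inv]
    by (simp_all add: assms[THEN permutes_inv_o(1)] assms[THEN permutes_inv_o(2)] blocks_id)
qed (auto simp: blocks_def)

lemma flip_blocks:
  assumes "p permutes {1..n}" "q permutes {1..n}"
  shows "flip n \<circ> blocks n p q = blocks n q p \<circ> flip n"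
proof
  fix i
  consider "i \<in> {1..n}" | j where "i = j + n" "j \<in> {1..n}" | "i \<notin> {1..2 * n}"
    by (rule two_blocks_cases)
  then show "(flip n \<circ> blocks n p q) i = (blocks n q p \<circ> flip n) i"
  proof cases
    case 1
    then show ?thesis using permutes_in_image[OF assms(1), of i] by (simp add: blocks_apply flip_apply del: atLeastAtMost_iff)
  next
    case 2
    then show ?thesis using permutes_in_image[OF assms(2), of j] by (simp add: blocks_apply flip_apply del: atLeastAtMost_iff)
  next
    case 3
    then show ?thesis by (simp add: blocks_apply flip_apply del: atLeastAtMost_iff)
  qed
qed

lemma blocks_inject:
  assumes "blocks n p q = blocks n p' q'"
    and "p permutes {1..n}" "q permutes {1..n}" "p' permutes {1..n}" "q' permutes {1..n}"
  shows "p = p'" "q = q'"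
proof -
  show "p = p'"
  proof
    fix i show "p i = p' i"
      using fun_cong[OF assms(1), of i] assms(2,4)[THEN permutes_not_in, of i]
      by (cases "i \<in> {1..n}") (simp_all add: blocks_apply del: atLeastAtMost_iff)
  qed
  show "q = q'"
  proof
    fix i show "q i = q' i"
      using fun_cong[OF assms(1), of "i + n"] assms(3,5)[THEN permutes_not_in, of i]
      by (cases "i \<in> {1..n}") (simp_all add: blocks_apply del: atLeastAtMost_iff)
  qed
qed

lemma wreath_perm_hom:
  "group_hom (wreath_Z2 (alt_group n)) (sym_group (2 * n)) (wreath_perm n)"
proof (intro group_hom.intro group_hom_axioms.intro homI)
  show "group (wreath_Z2 (alt_group n))" "group (sym_group (2 * n))"
    by (simp_all add: group_wreath_Z2 alt_group_is_group sym_group_is_group)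
next
  fix x assume "x \<in> carrier (wreath_Z2 (alt_group n))"
  then show "wreath_perm n x \<in> carrier (sym_group (2 * n))"
    by (auto simp: wreath_Z2_simps wreath_perm_def sym_group_carrier alt_group_carrier
        intro!: permutes_compose flip_permutes blocks_permutes simp del: One_nat_def)
next
  fix x y
  assume "x \<in> carrier (wreath_Z2 (alt_group n))" "y \<in> carrier (wreath_Z2 (alt_group n))"
  then obtain p q k p' q' l where x: "x = ((p, q), k)" and y: "y = ((p', q'), l)"
    and perm: "p permutes {1..n}" "q permutes {1..n}" "p' permutes {1..n}" "q' permutes {1..n}"
    and kl: "k = 0 \<or> k = 1" "l = 0 \<or> l = 1"
    by (auto simp: wreath_Z2_simps alt_group_carrier)
  have "blocks n p q \<circ> flip n \<circ> (blocks n p' q' \<circ> f) = blocks n (p \<circ> q') (q \<circ> p') \<circ> (flip n \<circ> f)" for f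
  proof -
    have "blocks n p q \<circ> flip n \<circ> (blocks n p' q' \<circ> f)
        = blocks n p q \<circ> (flip n \<circ> blocks n p' q') \<circ> f" by (simp add: comp_assoc)
    also have "\<dots> = (blocks n p q \<circ> blocks n q' p') \<circ> flip n \<circ> f"
      unfolding flip_blocks[OF perm(3,4)] by (simp add: comp_assoc)
    finally show ?thesis
      by (simp add: blocks_comp[OF perm(1,2,4,3)] comp_assoc)
  qed
  note swap = this
  have noswap: "blocks n p q \<circ> (blocks n p' q' \<circ> f) = blocks n (p \<circ> p') (q \<circ> q') \<circ> f" for f
    by (simp flip: comp_assoc add: blocks_comp[OF perm])
  from kl show "wreath_perm n (x \<otimes>\<^bsub>wreath_Z2 (alt_group n)\<^esub> y)
      = wreath_perm n x \<otimes>\<^bsub>sym_group (2 * n)\<^esub> wreath_perm n y"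
    using swap[of id] swap[of "flip n"] noswap[of id] noswap[of "flip n"]
    by (auto simp: x y wreath_Z2_simps wreath_perm_def sym_group_mult alt_group_mult flip_flip)
qed

lemma wreath_perm_inj:
  assumes "n > 0"
  shows "inj_on (wreath_perm n) (carrier (wreath_Z2 (alt_group n)))"
proof (rule inj_onI)
  fix x y
  assume "x \<in> carrier (wreath_Z2 (alt_group n))" "y \<in> carrier (wreath_Z2 (alt_group n))"
    and eq: "wreath_perm n x = wreath_perm n y"
  then obtain p q k p' q' l where x: "x = ((p, q), k)" and y: "y = ((p', q'), l)"
    and perm: "p permutes {1..n}" "q permutes {1..n}" "p' permutes {1..n}" "q' permutes {1..n}"
    and kl: "k = 0 \<or> k = 1" "l = 0 \<or> l = 1"
    by (auto simp: wreath_Z2_simps alt_group_carrier)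
  \<comment> \<open>the image of 1 lies in the first block exactly when the permutation preserves the blocks\<close>
  have small: "wreath_perm n ((r, s), m) 1 \<le> n \<longleftrightarrow> m = 0"
    if "r permutes {1..n}" "s permutes {1..n}" for r s m
  proof -
    have "r 1 \<in> {1..n}" "s 1 \<in> {1..n}" "(1::nat) \<in> {1..n}"
      using permutes_in_image[OF that(1), of 1] permutes_in_image[OF that(2), of 1] assms by auto
    then show ?thesis
      using blocks_apply(1,2)[of 1 n r s] flip_apply(1)[of 1 n] by (auto simp: wreath_perm_def)
  qed
  have "k = l"
    using small[OF perm(1,2), of k] small[OF perm(3,4), of l] eq kl by (auto simp: x y)
  moreover have "blocks n p q = blocks n p' q'"
  proof (cases "k = 0")
    case True
    then show ?thesis using eq \<open>k = l\<close> by (simp add: x y wreath_perm_def)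
  next
    case False
    then have "blocks n p q \<circ> flip n \<circ> flip n = blocks n p' q' \<circ> flip n \<circ> flip n"
      using eq \<open>k = l\<close> by (simp add: x y wreath_perm_def)
    then show ?thesis by (simp add: comp_assoc flip_flip)
  qed
  ultimately show "x = y" using blocks_inject[OF _ perm] by (simp add: x y)
qed

lemma sym_group_conj:
  assumes "\<psi> permutes {1..n}"
  shows "group_hom (sym_group n) (sym_group n) (\<lambda>p. \<psi> \<circ> p \<circ> inv' \<psi>)"
    and "inj (\<lambda>p. \<psi> \<circ> p \<circ> inv' \<psi>)"
proof -
  note inv = permutes_inv_o[OF assms]
  have cancel: "inv' \<psi> \<circ> (\<psi> \<circ> f) = f" "f \<circ> inv' \<psi> \<circ> \<psi> = f" for f :: "nat \<Rightarrow> nat"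
    by (simp_all add: inv comp_assoc flip: comp_assoc[of "inv' \<psi>" \<psi> f])
  show "group_hom (sym_group n) (sym_group n) (\<lambda>p. \<psi> \<circ> p \<circ> inv' \<psi>)"
  proof (intro group_hom.intro group_hom_axioms.intro homI sym_group_is_group)
    show "\<psi> \<circ> p \<circ> inv' \<psi> \<in> carrier (sym_group n)" if "p \<in> carrier (sym_group n)" for p
      using that assms permutes_inv[OF assms] by (simp add: sym_group_carrier permutes_compose)
    show "\<psi> \<circ> (p \<otimes>\<^bsub>sym_group n\<^esub> q) \<circ> inv' \<psi>
        = (\<psi> \<circ> p \<circ> inv' \<psi>) \<otimes>\<^bsub>sym_group n\<^esub> (\<psi> \<circ> q \<circ> inv' \<psi>)" for p q
      by (simp add: sym_group_mult comp_assoc cancel)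
  qed
  show "inj (\<lambda>p. \<psi> \<circ> p \<circ> inv' \<psi>)"
    by (rule inj_on_inverseI[of _ "\<lambda>p. inv' \<psi> \<circ> p \<circ> \<psi>"]) (simp add: comp_assoc cancel inv)
qed

section \<open>Generators of the wreath product of the alternating group on seven letters\<close>

text \<open>\<open>perm_a\<close> and \<open>perm_b\<close> are the actions of the black rotation on the two blocks of edges
  in the normal form.\<close>

definition perm_a :: "nat \<Rightarrow> nat" where
  "perm_a = cycle_of_list [1, 2, 3] \<circ> cycle_of_list [4, 5, 6]"

definition perm_b :: "nat \<Rightarrow> nat" where
  "perm_b = cycle_of_list [1, 4, 7]"

lemma three_cycle_alt:
  assumes "distinct [i, j, k]" "{i, j, k} \<subseteq> {1..n}"
  shows "cycle_of_list [i, j, k] \<in> carrier (alt_group n)"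
proof (rule set_mp[OF three_cycles_incl], intro CollectI exI conjI)
  show "cycle [i, j, k]" "set [i, j, k] \<subseteq> {1..n}" using assms by simp_all
qed simp_all

lemma perm_ab_alt: "perm_a \<in> carrier (alt_group 7)" "perm_b \<in> carrier (alt_group 7)"
proof -
  interpret A: group "alt_group 7" by (rule alt_group_is_group)
  show "perm_b \<in> carrier (alt_group 7)"
    unfolding perm_b_def by (rule three_cycle_alt) auto
  show "perm_a \<in> carrier (alt_group 7)"
    unfolding perm_a_def using A.m_closed[OF three_cycle_alt three_cycle_alt, of 1 2 3 4 5 6]
    by (simp add: alt_group_mult)
qed

lemma perm_a_apply: "perm_a i = (if i = 1 then 2 else if i = 2 then 3 else if i = 3 then 1
    else if i = 4 then 5 else if i = 5 then 6 else if i = 6 then 4 else i)"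
proof (cases "i \<in> {1, 2, 3, 4, 5, 6}")
  case True
  then show ?thesis by (elim insertE emptyE) (simp_all add: perm_a_def transpose_def)
next
  case False
  then have "cycle_of_list [1, 2, 3] i = i" "cycle_of_list [4, 5, 6] i = i"
    by (intro id_outside_supp; simp)+
  then show ?thesis using False by (simp add: perm_a_def del: cycle_of_list.simps)
qed

lemma perm_b_apply: "perm_b i = (if i = 1 then 4 else if i = 4 then 7 else if i = 7 then 1 else i)"
  by (auto simp: perm_b_def transpose_def)

text \<open>\<open>T\<close> contains both 3-cycles with support \<open>S\<close>.  Working with supports instead of 3-cycles
  avoids keeping track of their orientation and of their starting point.\<close>

definition has_triple :: "(nat \<Rightarrow> nat) set \<Rightarrow> nat set \<Rightarrow> bool" where
  "has_triple T S \<longleftrightarrow> (\<forall>i j k. distinct [i, j, k] \<and> S = {i, j, k} \<longrightarrow> cycle_of_list [i, j, k] \<in> T)"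

lemma cycle3_square: "distinct [i, j, k] \<Longrightarrow> cycle_of_list [i, j, k] \<circ> cycle_of_list [i, j, k] = cycle_of_list [k, j, i]"
  by (auto simp: fun_eq_iff transpose_def)

lemma cycle3_rotate: "distinct [i, j, k] \<Longrightarrow> cycle_of_list [j, k, i] = cycle_of_list [i, j, k]"
  by (auto simp: fun_eq_iff transpose_def)

lemma cycle3_conj:
  "distinct [i, j, k, l] \<Longrightarrow>
   cycle_of_list [i, j, l] \<circ> cycle_of_list [i, j, k] \<circ> cycle_of_list [l, j, i] = cycle_of_list [j, l, k]"
  by (auto simp: fun_eq_iff transpose_def)

lemma has_triple_iff:
  assumes comp: "\<And>p q. p \<in> T \<Longrightarrow> q \<in> T \<Longrightarrow> p \<circ> q \<in> T" and d: "distinct [i, j, k]"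
  shows "has_triple T {i, j, k} \<longleftrightarrow> cycle_of_list [i, j, k] \<in> T"
proof
  assume "has_triple T {i, j, k}"
  then show "cycle_of_list [i, j, k] \<in> T" using d unfolding has_triple_def by blast
next
  assume c: "cycle_of_list [i, j, k] \<in> T"
  then have c': "cycle_of_list [k, j, i] \<in> T"
    using comp[OF c c] cycle3_square[OF d] by simp
  have rots: "cycle_of_list [j, k, i] \<in> T" "cycle_of_list [k, i, j] \<in> T"
    "cycle_of_list [j, i, k] \<in> T" "cycle_of_list [i, k, j] \<in> T"
    using c c' cycle3_rotate[of i j k] cycle3_rotate[of j k i] cycle3_rotate[of k j i] cycle3_rotate[of j i k] d
    by simp_all
  show "has_triple T {i, j, k}"
    unfolding has_triple_def
  proof (intro allI impI)
    fix x y z assume xyz: "distinct [x, y, z] \<and> {i, j, k} = {x, y, z}"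
    then have "x \<in> {i, j, k}" "y \<in> {i, j, k}" "z \<in> {i, j, k}" "x \<noteq> y" "y \<noteq> z" "x \<noteq> z" by auto
    then show "cycle_of_list [x, y, z] \<in> T"
      using c c' rots by (elim insertE emptyE) (simp_all del: cycle_of_list.simps)
  qed
qed

text \<open>Conjugating a 3-cycle on \<open>{i, j, k}\<close> by one on \<open>{i, j, l}\<close> gives one on \<open>{j, k, l}\<close>.\<close>

lemma has_triple_share_edge:
  assumes comp: "\<And>p q. p \<in> T \<Longrightarrow> q \<in> T \<Longrightarrow> p \<circ> q \<in> T" and d: "distinct [i, j, k, l]"
    and "has_triple T {i, j, k}" "has_triple T {i, j, l}"
  shows "has_triple T {j, k, l}"
proof -
  have "{l, j, i} = {i, j, l}" by auto
  then have "cycle_of_list [i, j, l] \<in> T" "cycle_of_list [i, j, k] \<in> T" "cycle_of_list [l, j, i] \<in> T"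
    using assms(3,4) d unfolding has_triple_def by auto
  then have "cycle_of_list [j, l, k] \<in> T"
    using comp cycle3_conj[OF d] by metis
  then have "has_triple T {j, l, k}" using has_triple_iff[OF comp, of j l k] d by auto
  then show ?thesis by (simp add: insert_commute)
qed

lemma all_triples_from_common_edge:
  assumes comp: "\<And>p q. p \<in> T \<Longrightarrow> q \<in> T \<Longrightarrow> p \<circ> q \<in> T"
    and edge: "u \<noteq> v" "\<And>k. k \<in> X \<Longrightarrow> k \<noteq> u \<Longrightarrow> k \<noteq> v \<Longrightarrow> has_triple T {u, v, k}"
    and ijk: "distinct [i, j, k]" "i \<in> X" "j \<in> X" "k \<in> X"
  shows "has_triple T {i, j, k}"
proof -
  note share = has_triple_share_edge[OF comp]
  have with_u: "has_triple T {u, x, y}" if "x \<in> X" "y \<in> X" "distinct [u, x, y]" for x y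
  proof -
    consider "x = v" | "y = v" | "x \<noteq> v" "y \<noteq> v" by blast
    then show ?thesis
    proof cases
      case 1
      then show ?thesis using edge(2)[of y] that by simp
    next
      case 2
      have "{u, x, v} = {u, v, x}" by blast
      then show ?thesis using edge(2)[of x] that 2 by simp
    next
      case 3
      have "{v, u, x} = {u, v, x}" "{v, u, y} = {u, v, y}" by blast+
      then show ?thesis using share[of v u x y] edge(1) edge(2)[of x] edge(2)[of y] that 3 by simp
    qed
  qed
  consider "i = u" | "j = u" | "k = u" | "u \<notin> {i, j, k}" by blast
  then show ?thesis
  proof cases
    case 1
    then show ?thesis using with_u[of j k] ijk by simp
  next
    case 2
    have "{i, j, k} = {j, i, k}" by blast
    then show ?thesis using with_u[of i k] ijk 2 by simp
  next
    case 3
    have "{i, j, k} = {k, i, j}" by blast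
    then show ?thesis using with_u[of i j] ijk 3 by simp
  next
    case 4
    then show ?thesis using share[of u i j k] with_u[of i j] with_u[of i k] ijk by simp
  qed
qed

text \<open>The word \<open>w\<close> evaluates at \<open>(a, b)\<close> to \<open>(2 3 7)(1 5)(4 6)\<close> and at
  \<open>(b, a)\<close> to \<open>(3 4)(6 7)\<close>; squaring kills the transpositions and leaves a 3-cycle in the
  first coordinate only.\<close>

lemma three_cycle_times_id:
  assumes comp: "\<And>p p' q q'. (p, q) \<in> K \<Longrightarrow> (p', q') \<in> K \<Longrightarrow> (p \<circ> p', q \<circ> q') \<in> K"
    and ab_K: "(perm_a, perm_b) \<in> K" and ba_K: "(perm_b, perm_a) \<in> K"
  shows "(cycle_of_list [2, 7, 3], id) \<in> K"
proof -
  define ab ba where "ab = perm_a \<circ> perm_b" and "ba = perm_b \<circ> perm_a"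
  define w w' where "w = ab \<circ> ab \<circ> ab \<circ> perm_b \<circ> ab \<circ> ab \<circ> perm_b"
    and "w' = ba \<circ> ba \<circ> ba \<circ> perm_a \<circ> ba \<circ> ba \<circ> perm_a"
  note defs = w_def w'_def ab_def ba_def
  have outside: "perm_a i = i" "perm_b i = i" if "i \<notin> {1, 2, 3, 4, 5, 6, 7}" for i
    using that by (simp_all add: perm_a_apply perm_b_apply)
  have w: "w \<circ> w = cycle_of_list [2, 7, 3]"
  proof
    fix i show "(w \<circ> w) i = cycle_of_list [2, 7, 3] i"
    proof (cases "i \<in> {1, 2, 3, 4, 5, 6, 7}")
      case True
      then show ?thesis
        by (elim insertE emptyE) (simp_all add: w_def ab_def perm_a_apply perm_b_apply transpose_def)
    next
      case False
      then have "cycle_of_list [2, 7, 3] i = i" by (intro id_outside_supp) auto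
      then show ?thesis using outside[OF False] by (simp add: w_def ab_def del: cycle_of_list.simps)
    qed
  qed
  have w': "w' \<circ> w' = id"
  proof
    fix i show "(w' \<circ> w') i = id i"
    proof (cases "i \<in> {1, 2, 3, 4, 5, 6, 7}")
      case True
      then show ?thesis
        by (elim insertE emptyE) (simp_all add: w'_def ba_def perm_a_apply perm_b_apply)
    next
      case False
      then show ?thesis using outside[OF False] by (simp add: w'_def ba_def)
    qed
  qed
  have "(w \<circ> w, w' \<circ> w') \<in> K"
    unfolding defs by (intro comp ab_K ba_K)
  then show ?thesis by (simp only: w w')
qed

lemma generate_comp_closed:
  assumes "p \<in> generate (alt_group n) S" "\<And>q. q \<in> S \<Longrightarrow> q \<in> T" "S \<subseteq> carrier (alt_group n)"
    and "id \<in> T" "\<And>p q. p \<in> T \<Longrightarrow> q \<in> T \<Longrightarrow> p \<circ> q \<in> T" "\<And>q. q \<in> S \<Longrightarrow> inv' q \<in> T"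
  shows "p \<in> T"
  using assms(1)
proof induction
  case one
  then show ?case using assms(4) unfolding alt_group_one .
next
  case (inv h)
  then show ?case using assms(3,6) by (auto simp: alt_group_inv_equality)
next
  case (eng h1 h2)
  then show ?case using assms(5) unfolding alt_group_mult by blast
qed (use assms in auto)

lemma alt_group_subset_of_all_triples:
  assumes comp: "\<And>p q. p \<in> T \<Longrightarrow> q \<in> T \<Longrightarrow> p \<circ> q \<in> T" and "id \<in> T"
    and triples: "\<And>i j k. distinct [i, j, k] \<Longrightarrow> {i, j, k} \<subseteq> {1..n} \<Longrightarrow> has_triple T {i, j, k}"
  shows "carrier (alt_group n) \<subseteq> T"
proof
  have three: "q \<in> T \<and> inv' q \<in> T" if q: "q \<in> three_cycles n" for q
  proof -
    obtain cs where cs: "q = cycle_of_list cs" "distinct cs" "length cs = 3" "set cs \<subseteq> {1..n}"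
      using q by blast
    obtain i j k where ijk: "cs = [i, j, k]"
      using stupid_lemma[OF cs(3)] by blast
    have "cycle_of_list [i, j, k] \<in> T"
      using triples[of i j k] cs unfolding ijk has_triple_def by (simp del: cycle_of_list.simps)
    then have "cycle_of_list [i, j, k] \<in> T" "cycle_of_list [k, j, i] \<in> T"
      using comp[of "cycle_of_list [i, j, k]" "cycle_of_list [i, j, k]"] cycle3_square[of i j k] cs(2) ijk
      by (simp_all del: cycle_of_list.simps)
    moreover have "inv' q = cycle_of_list [k, j, i]"
    proof (rule inv_unique_comp)
      show "q \<circ> cycle_of_list [k, j, i] = id" "cycle_of_list [k, j, i] \<circ> q = id"
        using cs(1,2) ijk by (auto simp: fun_eq_iff transpose_def)
    qed
    ultimately show ?thesis using cs(1) ijk by simp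
  qed
  fix p assume "p \<in> carrier (alt_group n)"
  then have "p \<in> generate (alt_group n) (three_cycles n)"
    by (simp only: alt_group_carrier_as_three_cycles)
  then show "p \<in> T"
    by (rule generate_comp_closed) (use three comp \<open>id \<in> T\<close> three_cycles_incl in blast)+
qed

lemma wreath_A7_generated:
  "generate (wreath_Z2 (alt_group 7)) {((perm_a, perm_b), 0), ((id, id), 1)} = carrier (wreath_Z2 (alt_group 7))"
    (is "?\<Gamma> = carrier ?W")
proof -
  interpret A: group "alt_group 7" by (rule alt_group_is_group)
  interpret W: group ?W by (rule group_wreath_Z2[OF alt_group_is_group])
  have id7: "id \<in> carrier (alt_group 7)" using A.one_closed by (simp add: alt_group_one)
  have gens: "{((perm_a, perm_b), 0), ((id, id), 1)} \<subseteq> carrier ?W"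
    using perm_ab_alt id7 by (auto simp: wreath_Z2_simps)
  interpret S: subgroup ?\<Gamma> ?W by (rule W.generate_is_subgroup[OF gens])
  \<comment> \<open>the base group part of the generated subgroup\<close>
  define K where "K = {(p, q). ((p, q), 0) \<in> ?\<Gamma>}"
  have K_alt: "p \<in> carrier (alt_group 7)" "q \<in> carrier (alt_group 7)" if "(p, q) \<in> K" for p q
    using that S.subset by (auto simp: K_def wreath_Z2_simps)
  have K_comp: "(p \<circ> p', q \<circ> q') \<in> K" if "(p, q) \<in> K" "(p', q') \<in> K" for p q p' q'
    using S.m_closed[of "((p, q), 0)" "((p', q'), 0)"] that
    by (simp add: K_def wreath_Z2_simps alt_group_mult)
  have flip: "((id, id), 1) \<in> ?\<Gamma>" by (rule generate.incl) simp
  have K_swap: "(q, p) \<in> K" if "(p, q) \<in> K" for p q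
    using S.m_closed[OF S.m_closed[OF flip, of "((p, q), 0)"] flip] that
    by (simp add: K_def wreath_Z2_simps alt_group_mult)
  have K_id: "(id, id) \<in> K"
    using S.one_closed by (simp add: K_def wreath_Z2_simps alt_group_one)
  have K_inv: "(inv' p, inv' q) \<in> K" if "(p, q) \<in> K" for p q
  proof -
    note alt = K_alt[OF that]
    have "inv\<^bsub>?W\<^esub> ((p, q), 0) = ((inv' p, inv' q), 0)"
      using A.l_inv[OF alt(1)] A.l_inv[OF alt(2)] alt A.inv_closed[OF alt(1)] A.inv_closed[OF alt(2)]
      by (intro W.inv_equality) (simp_all add: wreath_Z2_simps alt_group_inv_equality)
    then show ?thesis using S.m_inv_closed[of "((p, q), 0)"] that by (simp add: K_def)
  qed
  have ab: "(perm_a, perm_b) \<in> K" unfolding K_def by (auto intro: generate.incl)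
  then have ba: "(perm_b, perm_a) \<in> K" by (rule K_swap)
  \<comment> \<open>the kernel of the projection of \<open>K\<close> to the second coordinate, seen in the first\<close>
  define T where "T = {p. (p, id) \<in> K}"
  have T_comp: "p \<circ> q \<in> T" if "p \<in> T" "q \<in> T" for p q
    using K_comp[of p id q id] that by (simp add: T_def)
  have id_T: "id \<in> T" using K_id by (simp add: T_def)
  have T_conj: "p \<circ> c \<circ> inv' p \<in> T" if "c \<in> T" "(p, q) \<in> K" for c p q
  proof -
    have "q \<circ> inv' q = id"
      using K_alt(2)[OF that(2)] permutes_inv_o(1) by (auto simp: alt_group_carrier)
    then show ?thesis
      using K_comp[OF K_comp[OF that(2), of c id] K_inv[OF that(2)]] that(1) by (simp add: T_def)
  qed
  have image: "has_triple T (p ` {i, j, k})" if "has_triple T {i, j, k}" "distinct [i, j, k]" "(p, q) \<in> K" for p q i j k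
  proof -
    have "bij p" using K_alt(1)[OF that(3)] by (auto simp: alt_group_carrier permutes_bij)
    then have d: "distinct [p i, p j, p k]" using that(2) by (auto simp: bij_def inj_eq)
    have "cycle_of_list [i, j, k] \<in> T" using that(1,2) unfolding has_triple_def by blast
    then have "cycle_of_list (map p [i, j, k]) \<in> T"
      using T_conj[OF _ that(3)] conjugation_of_cycle[OF that(2) \<open>bij p\<close>] by metis
    then show ?thesis using has_triple_iff[OF T_comp d] by simp
  qed
  note share = has_triple_share_edge[OF T_comp]
  have "cycle_of_list [2, 7, 3] \<in> T"
    unfolding T_def using three_cycle_times_id[OF K_comp ab ba] by simp
  then have base: "has_triple T {2, 7, 3}" by (subst has_triple_iff[OF T_comp]) auto
  \<comment> \<open>conjugate the triple \<open>{2, 3, 7}\<close> around until all triples containing 1 and 2 are reached\<close>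
  have t237: "has_triple T {2, 3, 7}" using base by (simp add: insert_commute)
  have t137: "has_triple T {1, 3, 7}"
    using image[OF t237 _ ab] by (simp add: perm_a_apply insert_commute)
  have t127: "has_triple T {1, 2, 7}"
    using image[OF t137 _ ab] by (simp add: perm_a_apply insert_commute)
  have t123: "has_triple T {1, 2, 3}"
    using image[OF t237 _ ba] by (simp add: perm_b_apply insert_commute)
  have t234: "has_triple T {2, 3, 4}"
    using image[OF t123 _ ba] by (simp add: perm_b_apply insert_commute)
  have t135: "has_triple T {1, 3, 5}"
    using image[OF t234 _ ab] by (simp add: perm_a_apply insert_commute)
  have t126: "has_triple T {1, 2, 6}"
    using image[OF t135 _ ab] by (simp add: perm_a_apply insert_commute)
  have t124: "has_triple T {1, 2, 4}"
    using share[of 3 2 1 4] t123 t234 by (simp add: insert_commute)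
  have t125: "has_triple T {1, 2, 5}"
    using share[of 3 1 2 5] t123 t135 by (simp add: insert_commute)
  have "carrier (alt_group 7) \<subseteq> T"
  proof (rule alt_group_subset_of_all_triples[OF T_comp id_T])
    fix i j k :: nat assume ijk: "distinct [i, j, k]" "{i, j, k} \<subseteq> {1..7}"
    have "has_triple T {1, 2, l}" if "l \<in> {1..7}" "l \<noteq> 1" "l \<noteq> 2" for l
    proof -
      have "l \<in> {3, 4, 5, 6, 7}" using that by auto
      then show ?thesis using t123 t124 t125 t126 t127 by blast
    qed
    then show "has_triple T {i, j, k}"
      using all_triples_from_common_edge[OF T_comp, of 1 2 "{1..7}" i j k] ijk by simp
  qed
  then have K_all: "(p, q) \<in> K" if "p \<in> carrier (alt_group 7)" "q \<in> carrier (alt_group 7)" for p q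
    using K_comp[of p id id q] K_swap[of q id] that by (auto simp: T_def)
  show ?thesis
  proof
    show "?\<Gamma> \<subseteq> carrier ?W" by (rule S.subset)
    show "carrier ?W \<subseteq> ?\<Gamma>"
    proof
      fix x assume "x \<in> carrier ?W"
      then obtain p q k where x: "x = ((p, q), k)" "(p, q) \<in> K" "k = 0 \<or> k = 1"
        using K_all by (auto simp: wreath_Z2_simps)
      then show "x \<in> ?\<Gamma>"
        using S.m_closed[OF _ flip, of "((p, q), 0)"]
        by (auto simp: K_def wreath_Z2_simps alt_group_mult)
    qed
  qed
qed

section \<open>Dessins and the rotations of their edges\<close>

lemma cyclic_on_card:
  assumes "cyclic_on f S" "s \<in> S"
  shows "S = (\<lambda>i. (f ^^ i) s) ` {..<card S}" and "(f ^^ card S) s = s"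
proof -
  have S: "S = orbit f s" and s: "s \<in> orbit f s" using assms by (auto simp: cyclic_on_alldef)
  have "card S = funpow_dist1 f s s"
    using card_image[OF inj_on_funpow_dist1[OF s]] orbit_conv_funpow_dist1[OF s] S by simp
  then show "S = (\<lambda>i. (f ^^ i) s) ` {..<card S}" and "(f ^^ card S) s = s"
    using orbit_conv_funpow_dist1[OF s] funpow_dist1_prop[OF s] S by (simp_all add: lessThan_atLeast0)
qed

text \<open>The successor of an edge around its black end; this is the permutation \<open>sigma0\<close> before labeling
  the edges.\<close>

definition black_next :: "('v, 'e) dessin \<Rightarrow> 'e \<Rightarrow> 'e" where
  "black_next D e = rot D (black_end D e) e"

text \<open>The successor of an edge around its white end.\<close>

definition white_next :: "('v, 'e) dessin \<Rightarrow> 'e \<Rightarrow> 'e" where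
  "white_next D e = rot D (white_end D e) e"

lemma dessin_ends:
  assumes "is_dessin D" "e \<in> edges D"
  shows "black_end D e \<in> black D" "white_end D e \<in> white D"
  using assms by (auto simp: is_dessin_def)

lemma incident_black:
  assumes "is_dessin D" "v \<in> black D"
  shows "incident D v = {e \<in> edges D. black_end D e = v}"
  using assms by (auto simp: is_dessin_def incident_def ends_def)

lemma incident_white:
  assumes "is_dessin D" "v \<in> white D"
  shows "incident D v = {e \<in> edges D. white_end D e = v}"
  using assms by (auto simp: is_dessin_def incident_def ends_def)

lemma incident_cyclic:
  assumes "is_dessin D" "v \<in> verts D" "e \<in> incident D v"
  shows "cyclic_on (rot D v) (incident D v)"
  using assms by (auto simp: is_dessin_def)

lemma black_next_edge:
  assumes "is_dessin D" "e \<in> edges D"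
  shows "black_next D e \<in> edges D" "black_end D (black_next D e) = black_end D e"
proof -
  note b = dessin_ends(1)[OF assms]
  have "rot D (black_end D e) e \<in> incident D (black_end D e)"
    using incident_black[OF assms(1) b] assms b
    by (intro cyclic_on_inI[OF incident_cyclic]) (auto simp: verts_def)
  then show "black_next D e \<in> edges D" "black_end D (black_next D e) = black_end D e"
    using incident_black[OF assms(1) b] by (auto simp: black_next_def)
qed

lemma white_next_edge:
  assumes "is_dessin D" "e \<in> edges D"
  shows "white_next D e \<in> edges D" "white_end D (white_next D e) = white_end D e"
proof -
  note w = dessin_ends(2)[OF assms]
  have "rot D (white_end D e) e \<in> incident D (white_end D e)"
    using incident_white[OF assms(1) w] assms w
    by (intro cyclic_on_inI[OF incident_cyclic]) (auto simp: verts_def)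
  then show "white_next D e \<in> edges D" "white_end D (white_next D e) = white_end D e"
    using incident_white[OF assms(1) w] by (auto simp: white_next_def)
qed

lemma black_star_induct:
  assumes D: "is_dessin D" and e: "e \<in> edges D" and e': "e' \<in> edges D"
    and same: "black_end D e' = black_end D e"
    and base: "P e" and step: "\<And>x. x \<in> edges D \<Longrightarrow> black_end D x = black_end D e \<Longrightarrow> P x \<Longrightarrow> P (black_next D x)"
  shows "P e'"
proof -
  let ?v = "black_end D e"
  note b = dessin_ends(1)[OF D e]
  have inc: "e \<in> incident D ?v" "e' \<in> incident D ?v"
    using incident_black[OF D b] e e' same by auto
  have "e' \<in> orbit (rot D ?v) e"
    using incident_cyclic[OF D _ inc(1)] b inc by (auto simp: verts_def cyclic_on_alldef)
  then have "e' \<in> edges D \<and> black_end D e' = ?v \<and> P e'"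
  proof induction
    case base
    then show ?case using black_next_edge[OF D e] step[OF e _ \<open>P e\<close>] by (simp add: black_next_def)
  next
    case (step y)
    then show ?case using black_next_edge[OF D, of y] assms(6)[of y] by (simp add: black_next_def)
  qed
  then show ?thesis by simp
qed

lemma white_star_induct:
  assumes D: "is_dessin D" and e: "e \<in> edges D" and e': "e' \<in> edges D"
    and same: "white_end D e' = white_end D e"
    and base: "P e" and step: "\<And>x. x \<in> edges D \<Longrightarrow> white_end D x = white_end D e \<Longrightarrow> P x \<Longrightarrow> P (white_next D x)"
  shows "P e'"
proof -
  let ?v = "white_end D e"
  note b = dessin_ends(2)[OF D e]
  have inc: "e \<in> incident D ?v" "e' \<in> incident D ?v"
    using incident_white[OF D b] e e' same by auto
  have "e' \<in> orbit (rot D ?v) e"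
    using incident_cyclic[OF D _ inc(1)] b inc by (auto simp: verts_def cyclic_on_alldef)
  then have "e' \<in> edges D \<and> white_end D e' = ?v \<and> P e'"
  proof induction
    case base
    then show ?case using white_next_edge[OF D e] step[OF e _ \<open>P e\<close>] by (simp add: white_next_def)
  next
    case (step y)
    then show ?case using white_next_edge[OF D, of y] assms(6)[of y] by (simp add: white_next_def)
  qed
  then show ?thesis by simp
qed

lemma monodromy_transitive:
  assumes D: "is_dessin D" and S: "S \<subseteq> edges D" "S \<noteq> {}"
    and closed: "\<And>e. e \<in> S \<Longrightarrow> black_next D e \<in> S" "\<And>e. e \<in> S \<Longrightarrow> white_next D e \<in> S"
  shows "S = edges D"
proof -
  define V where "V = black_end D ` S \<union> white_end D ` S"
  have inc_S: "e \<in> S" if e: "e \<in> edges D" and v: "v \<in> ends D e" "v \<in> V" for e v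
  proof -
    have disj: "black D \<inter> white D = {}" using D by (simp add: is_dessin_def)
    obtain s where s: "s \<in> S" "v = black_end D s \<or> v = white_end D s"
      using v(2) by (auto simp: V_def)
    then have sE: "s \<in> edges D" using S by auto
    consider "black_end D e = black_end D s" | "white_end D e = white_end D s"
      using s(2) v(1) disj dessin_ends[OF D sE] dessin_ends[OF D e] by (auto simp: ends_def)
    then show "e \<in> S"
    proof cases
      case 1
      show ?thesis by (rule black_star_induct[OF D sE e 1, of "\<lambda>x. x \<in> S"]) (use s closed in auto)
    next
      case 2
      show ?thesis by (rule white_star_induct[OF D sE e 2, of "\<lambda>x. x \<in> S"]) (use s closed in auto)
    qed
  qed
  obtain s where s: "s \<in> S" using S by blast
  have reach: "v \<in> V" if "(black_end D s, v) \<in> (adj D)\<^sup>*" for v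
    using that
  proof induction
    case base
    then show ?case using s by (simp add: V_def)
  next
    case (step y z)
    then obtain e where e: "e \<in> edges D" "ends D e = {y, z}" by (auto simp: adj_def)
    then have "e \<in> S" using inc_S[of e y] step.IH by auto
    then show ?case using e(2) by (auto simp: V_def ends_def doubleton_eq_iff)
  qed
  have "e \<in> S" if e: "e \<in> edges D" for e
  proof -
    have "(black_end D s, black_end D e) \<in> (adj D)\<^sup>*"
      using D dessin_ends(1)[OF D e] dessin_ends(1)[OF D, of s] s S
      by (auto simp: is_dessin_def connected_graph_def verts_def)
    then show "e \<in> S" using reach inc_S[OF e, of "black_end D e"] by (auto simp: ends_def)
  qed
  then show ?thesis using S by auto
qed

lemma degree_pos_incident: "degree D v \<noteq> 0 \<Longrightarrow> \<exists>e\<in>edges D. e \<in> incident D v"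
  unfolding degree_def by (metis card.empty ex_in_conv incident_def mem_Collect_eq)

text \<open>If there are no isolated vertices, the vertices of either color are the cycles of the corresponding
  rotation of the edges.  So a bijection of the edges that commutes with both rotations determines an
  isomorphism; equality of passports is used only to count the vertices.\<close>

lemma dessin_isomorphicI:
  fixes D :: "('v, 'e) dessin" and D' :: "('w, 'f) dessin"
  assumes D: "is_dessin D" and D': "is_dessin D'"
    and pass: "passport D = passport D'"
    and deg: "\<And>v. v \<in> verts D' \<Longrightarrow> degree D' v \<noteq> 0" "\<And>v. v \<in> verts D \<Longrightarrow> degree D v \<noteq> 0"
    and g: "bij_betw g (edges D) (edges D')"
    and black: "\<And>e. e \<in> edges D \<Longrightarrow> g (black_next D e) = black_next D' (g e)"
    and white: "\<And>e. e \<in> edges D \<Longrightarrow> g (white_next D e) = white_next D' (g e)"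
  shows "dessin_isomorphic D D'"
proof -
  have gE: "g e \<in> edges D'" if "e \<in> edges D" for e using g that by (auto simp: bij_betw_def)
  have same_black: "black_end D' (g e') = black_end D' (g e)"
    if "e \<in> edges D" "e' \<in> edges D" "black_end D e' = black_end D e" for e e'
    by (rule black_star_induct[OF D that]) (use black black_next_edge(2)[OF D'] gE in auto)
  have same_white: "white_end D' (g e') = white_end D' (g e)"
    if "e \<in> edges D" "e' \<in> edges D" "white_end D e' = white_end D e" for e e'
    by (rule white_star_induct[OF D that]) (use white white_next_edge(2)[OF D'] gE in auto)
  have disj: "black D \<inter> white D = {}" "finite (black D)" "finite (white D)" "finite (black D')" "finite (white D')"
    using D D' by (auto simp: is_dessin_def verts_def)
  define f where "f v = (if v \<in> black D
      then black_end D' (g (SOME e. e \<in> edges D \<and> black_end D e = v))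
      else white_end D' (g (SOME e. e \<in> edges D \<and> white_end D e = v)))" for v
  have f_black: "f (black_end D e) = black_end D' (g e)" if e: "e \<in> edges D" for e
  proof -
    have "(SOME x. x \<in> edges D \<and> black_end D x = black_end D e) \<in> edges D
        \<and> black_end D (SOME x. x \<in> edges D \<and> black_end D x = black_end D e) = black_end D e"
      by (rule someI_ex) (use e in blast)
    then show ?thesis using same_black[OF e] dessin_ends(1)[OF D e] by (simp add: f_def)
  qed
  have f_white: "f (white_end D e) = white_end D' (g e)" if e: "e \<in> edges D" for e
  proof -
    have "(SOME x. x \<in> edges D \<and> white_end D x = white_end D e) \<in> edges D
        \<and> white_end D (SOME x. x \<in> edges D \<and> white_end D x = white_end D e) = white_end D e"
      by (rule someI_ex) (use e in blast)
    moreover have "white_end D e \<notin> black D" using dessin_ends(2)[OF D e] disj by auto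
    ultimately show ?thesis using same_white[OF e] by (simp add: f_def)
  qed
  have card_eq: "card (black D) = card (black D')" "card (white D) = card (white D')"
  proof -
    have "size (fst (passport D)) = size (fst (passport D'))" "size (snd (passport D)) = size (snd (passport D'))"
      using pass by simp_all
    then show "card (black D) = card (black D')" "card (white D) = card (white D')"
      by (simp_all add: passport_def)
  qed
  have img_black: "f ` black D = black D'"
  proof
    show "f ` black D \<subseteq> black D'"
    proof clarify
      fix v assume v: "v \<in> black D"
      then obtain e where "e \<in> edges D" "black_end D e = v"
        using degree_pos_incident[OF deg(2), of v] incident_black[OF D v] by (auto simp: verts_def)
      then show "f v \<in> black D'" using f_black dessin_ends(1)[OF D' gE] by metis
    qed
    show "black D' \<subseteq> f ` black D"
    proof
      fix v assume v: "v \<in> black D'"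
      then obtain e' where e': "e' \<in> edges D'" "black_end D' e' = v"
        using degree_pos_incident[OF deg(1), of v] incident_black[OF D' v] by (auto simp: verts_def)
      then have "e' \<in> g ` edges D" using bij_betw_imp_surj_on[OF g] by simp
      then obtain e where "e \<in> edges D" "g e = e'" by blast
      then show "v \<in> f ` black D" using f_black dessin_ends(1)[OF D] e' by force
    qed
  qed
  have img_white: "f ` white D = white D'"
  proof
    show "f ` white D \<subseteq> white D'"
    proof clarify
      fix v assume v: "v \<in> white D"
      then obtain e where "e \<in> edges D" "white_end D e = v"
        using degree_pos_incident[OF deg(2), of v] incident_white[OF D v] by (auto simp: verts_def)
      then show "f v \<in> white D'" using f_white dessin_ends(2)[OF D' gE] by metis
    qed
    show "white D' \<subseteq> f ` white D"
    proof
      fix v assume v: "v \<in> white D'"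
      then obtain e' where e': "e' \<in> edges D'" "white_end D' e' = v"
        using degree_pos_incident[OF deg(1), of v] incident_white[OF D' v] by (auto simp: verts_def)
      then have "e' \<in> g ` edges D" using bij_betw_imp_surj_on[OF g] by simp
      then obtain e where "e \<in> edges D" "g e = e'" by blast
      then show "v \<in> f ` white D" using f_white dessin_ends(2)[OF D] e' by force
    qed
  qed
  have "bij_betw f (black D) (black D')" "bij_betw f (white D) (white D')"
    using img_black img_white card_eq disj by (auto simp: bij_betw_def intro: eq_card_imp_inj_on)
  moreover have "g (rot D v e) = rot D' (f v) (g e)" if "v \<in> verts D" "e \<in> incident D v" for v e
  proof -
    have e: "e \<in> edges D" and v: "v = black_end D e \<or> v = white_end D e"
      using that by (auto simp: incident_def ends_def)
    then show ?thesis
      using black[OF e] white[OF e] f_black[OF e] f_white[OF e]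
      by (auto simp: black_next_def white_next_def)
  qed
  ultimately show ?thesis
    unfolding dessin_isomorphic_def using g f_black f_white by (intro exI[of _ f] exI[of _ g]) auto
qed

lemma count_image_mset_set:
  "finite A \<Longrightarrow> count (image_mset f (mset_set A)) y = card {x \<in> A. f x = y}"
proof (induction A rule: finite_induct)
  case (insert a A)
  have "{x \<in> insert a A. f x = y} = (if f a = y then insert a {x \<in> A. f x = y} else {x \<in> A. f x = y})"
    by auto
  then show ?case using insert by simp
qed simp

lemma card_black_stars:
  assumes D: "is_dessin D" and A: "A \<subseteq> black D" "\<And>v. v \<in> A \<Longrightarrow> degree D v = d"
  shows "card {e \<in> edges D. black_end D e \<in> A} = card A * d"
proof -
  have fin: "finite A" "finite (edges D)"
    using D A(1) finite_subset by (auto simp: is_dessin_def verts_def)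
  have "{e \<in> edges D. black_end D e \<in> A} = (\<Union>v\<in>A. {e \<in> edges D. black_end D e = v})" by auto
  also have "card \<dots> = (\<Sum>v\<in>A. card {e \<in> edges D. black_end D e = v})"
    by (rule card_UN_disjoint) (use fin in auto)
  also have "\<dots> = (\<Sum>v\<in>A. d)"
  proof (rule sum.cong)
    fix v assume "v \<in> A"
    then show "card {e \<in> edges D. black_end D e = v} = d"
      using A(2)[of v] incident_black[OF D, of v] A(1) by (auto simp: degree_def)
  qed simp
  finally show ?thesis by simp
qed

lemma card_white_stars:
  assumes D: "is_dessin D" and A: "\<And>v. v \<in> white D \<Longrightarrow> degree D v = d"
  shows "card (edges D) = card (white D) * d"
proof -
  have fin: "finite (white D)" "finite (edges D)"
    using D by (auto simp: is_dessin_def verts_def)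
  have "edges D = (\<Union>v\<in>white D. {e \<in> edges D. white_end D e = v})" using dessin_ends(2)[OF D] by auto
  also have "card \<dots> = (\<Sum>v\<in>white D. card {e \<in> edges D. white_end D e = v})"
    by (rule card_UN_disjoint) (use fin in auto)
  also have "\<dots> = (\<Sum>v\<in>white D. d)"
  proof (rule sum.cong)
    fix v assume "v \<in> white D"
    then show "card {e \<in> edges D. white_end D e = v} = d"
      using A[of v] incident_white[OF D, of v] by (simp add: degree_def)
  qed simp
  finally show ?thesis by simp
qed

lemma rot_black_leaf:
  assumes D: "is_dessin D" and e: "e \<in> edges D" and d: "degree D (black_end D e) = 1"
  shows "black_next D e = e"
proof -
  let ?v = "black_end D e"
  have v: "?v \<in> black D" using dessin_ends(1)[OF D e] .
  then have i: "e \<in> incident D ?v" using e by (simp add: incident_black[OF D])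
  have "cyclic_on (rot D ?v) (incident D ?v)" using incident_cyclic[OF D _ i] v by (simp add: verts_def)
  then show ?thesis using cyclic_on_card(2)[OF _ i] d by (simp add: degree_def black_next_def)
qed

lemma rot_black_trivalent:
  assumes D: "is_dessin D" and e: "e \<in> edges D" and d: "degree D (black_end D e) = 3"
  shows "{x \<in> edges D. black_end D x = black_end D e} = {e, black_next D e, black_next D (black_next D e)}"
    and "black_next D (black_next D (black_next D e)) = e"
    and "distinct [e, black_next D e, black_next D (black_next D e)]"
proof -
  let ?v = "black_end D e"
  have v: "?v \<in> black D" using dessin_ends(1)[OF D e] .
  then have i: "e \<in> incident D ?v" using e by (simp add: incident_black[OF D])
  have c: "cyclic_on (rot D ?v) (incident D ?v)" using incident_cyclic[OF D _ i] v by (simp add: verts_def)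
  have next1: "rot D ?v e = black_next D e" by (simp add: black_next_def)
  have next2: "rot D ?v (black_next D e) = black_next D (black_next D e)"
    using black_next_edge(2)[OF D e] by (simp add: black_next_def[of D "black_next D e"])
  have next3: "rot D ?v (black_next D (black_next D e)) = black_next D (black_next D (black_next D e))"
    using black_next_edge(2)[OF D e] black_next_edge(2)[OF D black_next_edge(1)[OF D e]]
    by (simp add: black_next_def[of D "black_next D (black_next D e)"])
  have three: "card (incident D ?v) = 3" using d by (simp add: degree_def)
  have lt3: "{..<3::nat} = {0, 1, 2}" by auto
  have inc: "incident D ?v = {e, black_next D e, black_next D (black_next D e)}"
    using cyclic_on_card(1)[OF c i] unfolding three lt3 by (simp add: next1 next2 numeral_2_eq_2)
  then show "{x \<in> edges D. black_end D x = black_end D e} = {e, black_next D e, black_next D (black_next D e)}"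
    using incident_black[OF D v] by simp
  show "black_next D (black_next D (black_next D e)) = e"
    using cyclic_on_card(2)[OF c i] unfolding three by (simp add: next1 next2 next3 numeral_3_eq_3)
  show "distinct [e, black_next D e, black_next D (black_next D e)]"
    using three unfolding inc by (intro card_distinct) simp
qed

lemma rot_white_bivalent:
  assumes D: "is_dessin D" and e: "e \<in> edges D" and d: "degree D (white_end D e) = 2"
  shows "white_next D (white_next D e) = e" "white_next D e \<noteq> e"
proof -
  let ?v = "white_end D e"
  have v: "?v \<in> white D" using dessin_ends(2)[OF D e] .
  then have i: "e \<in> incident D ?v" using e by (simp add: incident_white[OF D])
  have c: "cyclic_on (rot D ?v) (incident D ?v)" using incident_cyclic[OF D _ i] v by (simp add: verts_def)
  have next1: "rot D ?v e = white_next D e" by (simp add: white_next_def)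
  have next2: "rot D ?v (white_next D e) = white_next D (white_next D e)"
    using white_next_edge(2)[OF D e] by (simp add: white_next_def[of D "white_next D e"])
  have two: "card (incident D ?v) = 2" using d by (simp add: degree_def)
  have lt2: "{..<2::nat} = {0, 1}" by auto
  have inc: "incident D ?v = {e, white_next D e}"
    using cyclic_on_card(1)[OF c i] unfolding two lt2 by (simp add: next1)
  show "white_next D (white_next D e) = e"
    using cyclic_on_card(2)[OF c i] unfolding two by (simp add: next1 next2 numeral_2_eq_2)
  show "white_next D e \<noteq> e"
    using two unfolding inc by auto
qed

section \<open>The normal form of a dessin with the given passport\<close>

lemma one_to_fourteen: "{1..14::nat} = {1, 2, 3, 4, 5, 6, 7, 8, 9, 10, 11, 12, 13, 14}"
proof -
  have "{1..14::nat} = set [1..<15]" by auto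
  also have "[1..<15] = [1, 2, 3, 4, 5, 6, 7, 8, 9, 10, 11, 12, 13, 14::nat]" by (simp add: upt_rec)
  finally show ?thesis by simp
qed

text \<open>Connectedness together with the passport, which gives 15 vertices and 14 edges, forces such a dessin
  to be a tree.\<close>

locale dessin_with_passport =
  fixes D :: "('v, 'e) dessin"
  assumes dessin: "is_dessin D"
    and passport: "passport D = (replicate_mset 3 3 + replicate_mset 5 1, replicate_mset 7 2)"
begin

abbreviation "s0 \<equiv> black_next D"
abbreviation "s1 \<equiv> white_next D"
abbreviation "\<beta> \<equiv> black_end D"

lemma finite_sets: "finite (black D)" "finite (white D)" "finite (edges D)"
  using dessin by (auto simp: is_dessin_def verts_def)

lemma degree_black: "v \<in> black D \<Longrightarrow> degree D v = 3 \<or> degree D v = 1"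
proof -
  assume "v \<in> black D"
  then have "degree D v \<in># fst (passport D)" using finite_sets by (simp add: passport_def)
  then show ?thesis by (auto simp: passport)
qed

lemma degree_white: "v \<in> white D \<Longrightarrow> degree D v = 2"
proof -
  assume "v \<in> white D"
  then have "degree D v \<in># snd (passport D)" using finite_sets by (simp add: passport_def)
  then show ?thesis by (auto simp: passport)
qed

lemma degree_nonzero: "v \<in> verts D \<Longrightarrow> degree D v \<noteq> 0"
  using degree_black[of v] degree_white[of v] by (auto simp: verts_def)

lemma card_degree:
  "card {v \<in> black D. degree D v = 3} = 3" "card {v \<in> black D. degree D v = 1} = 5"
proof -
  have "count (fst (passport D)) d = card {v \<in> black D. degree D v = d}" for d
    using finite_sets by (simp add: passport_def count_image_mset_set)
  from this[of 3] this[of 1] show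
    "card {v \<in> black D. degree D v = 3} = 3" "card {v \<in> black D. degree D v = 1} = 5"
    by (simp_all add: passport)
qed

lemma card_edges: "card (edges D) = 14"
proof -
  have "card (white D) = size (snd (passport D))" by (simp add: passport_def)
  then show ?thesis using card_white_stars[OF dessin degree_white] by (simp add: passport)
qed

lemma s0_edge [simp]: "e \<in> edges D \<Longrightarrow> s0 e \<in> edges D" "e \<in> edges D \<Longrightarrow> \<beta> (s0 e) = \<beta> e"
  using black_next_edge[OF dessin] by auto

lemma s1_edge [simp]: "e \<in> edges D \<Longrightarrow> s1 e \<in> edges D" "e \<in> edges D \<Longrightarrow> s1 (s1 e) = e"
  using white_next_edge(1)[OF dessin] rot_white_bivalent(1)[OF dessin _ degree_white[OF dessin_ends(2)[OF dessin]]]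
  by auto

lemma s1_inj: "inj_on s1 (edges D)"
  by (rule inj_on_inverseI[of _ s1]) simp

lemma closed_subset_card:
  assumes "S \<subseteq> edges D" "S \<noteq> {}" "\<And>e. e \<in> S \<Longrightarrow> s0 e \<in> S" "\<And>e. e \<in> S \<Longrightarrow> s1 e \<in> S"
  shows "card S = 14"
  using monodromy_transitive[OF dessin assms] card_edges by simp

text \<open>The edges at black vertices of degree one and at black vertices of degree three.\<close>

definition "leaf_edges = {e \<in> edges D. degree D (\<beta> e) = 1}"
definition "star_edges = {e \<in> edges D. degree D (\<beta> e) = 3}"

text \<open>A bridge is an edge at a trivalent black vertex whose white end leads to a trivalent black vertex
  again.\<close>

definition "bridges = {e \<in> star_edges. s1 e \<in> star_edges}"

lemma edges_split: "e \<in> edges D \<Longrightarrow> e \<in> leaf_edges \<or> e \<in> star_edges"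
  using degree_black[OF dessin_ends(1)[OF dessin, of e]] by (auto simp: leaf_edges_def star_edges_def)

lemma leaf_edge: "e \<in> leaf_edges \<Longrightarrow> e \<in> edges D" "e \<in> leaf_edges \<Longrightarrow> e \<notin> star_edges"
  by (auto simp: leaf_edges_def star_edges_def)

lemma card_leaf_star: "card leaf_edges = 5" "card star_edges = 9"
proof -
  have stars: "card {e \<in> edges D. degree D (\<beta> e) = d} = card {v \<in> black D. degree D v = d} * d" for d
  proof -
    have "{e \<in> edges D. degree D (\<beta> e) = d} = {e \<in> edges D. \<beta> e \<in> {v \<in> black D. degree D v = d}}"
      using dessin_ends(1)[OF dessin] by blast
    moreover have "card \<dots> = card {v \<in> black D. degree D v = d} * d"
      by (rule card_black_stars[OF dessin]) blast+
    ultimately show ?thesis by argo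
  qed
  show "card leaf_edges = 5" "card star_edges = 9"
    unfolding leaf_edges_def star_edges_def stars card_degree by simp_all
qed

lemma s0_leaf: "e \<in> leaf_edges \<Longrightarrow> s0 e = e"
  using rot_black_leaf[OF dessin] by (auto simp: leaf_edges_def)

lemma star:
  assumes "e \<in> star_edges"
  shows "{x \<in> edges D. \<beta> x = \<beta> e} = {e, s0 e, s0 (s0 e)}" "s0 (s0 (s0 e)) = e"
    "distinct [e, s0 e, s0 (s0 e)]" "e \<in> edges D" "s0 e \<in> star_edges" "s0 (s0 e) \<in> star_edges"
proof -
  have e: "e \<in> edges D" "degree D (\<beta> e) = 3" using assms by (simp_all add: star_edges_def)
  show "{x \<in> edges D. \<beta> x = \<beta> e} = {e, s0 e, s0 (s0 e)}" "s0 (s0 (s0 e)) = e"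
    "distinct [e, s0 e, s0 (s0 e)]" "e \<in> edges D"
    by (fact rot_black_trivalent[OF dessin e] e)+
  show "s0 e \<in> star_edges" "s0 (s0 e) \<in> star_edges" using e by (simp_all add: star_edges_def)
qed

lemma leaf_not_paired: "e \<in> leaf_edges \<Longrightarrow> s1 e \<in> star_edges"
proof (rule ccontr)
  assume e: "e \<in> leaf_edges" and "s1 e \<notin> star_edges"
  then have eE: "e \<in> edges D" "s1 e \<in> leaf_edges"
    using edges_split[OF s1_edge(1), of e] leaf_edge(1) by auto
  have "card {e, s1 e} = 14"
    by (rule closed_subset_card) (use e eE s0_leaf in auto)
  moreover have "card {e, s1 e} \<le> 2" by (simp add: card_insert_if)
  ultimately show False by simp
qed

lemma star_not_bridge: "e \<in> star_edges \<Longrightarrow> e \<notin> bridges \<Longrightarrow> s1 e \<in> leaf_edges"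
  using edges_split[OF s1_edge(1), of e] star(4)[of e] by (auto simp: bridges_def)

lemma card_bridges: "card bridges = 4"
proof -
  have "star_edges - bridges = s1 ` leaf_edges"
  proof
    show "star_edges - bridges \<subseteq> s1 ` leaf_edges"
    proof
      fix e assume e: "e \<in> star_edges - bridges"
      then have "s1 e \<in> leaf_edges" "e = s1 (s1 e)"
        using star_not_bridge[of e] star(4)[of e] by simp_all
      then show "e \<in> s1 ` leaf_edges" by blast
    qed
    show "s1 ` leaf_edges \<subseteq> star_edges - bridges"
    proof clarify
      fix e assume e: "e \<in> leaf_edges"
      then have "s1 (s1 e) \<notin> star_edges" using leaf_edge[OF e] by simp
      then show "s1 e \<in> star_edges - bridges"
        using leaf_not_paired[OF e] by (simp add: bridges_def)
    qed
  qed
  moreover have "inj_on s1 leaf_edges"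
    using inj_on_subset[OF s1_inj] leaf_edge(1) by blast
  ultimately have "card (star_edges - bridges) = 5" using card_leaf_star(1) by (simp add: card_image)
  moreover have fin: "finite star_edges" "bridges \<subseteq> star_edges"
    using finite_sets by (auto simp: star_edges_def bridges_def)
  ultimately show ?thesis
    using card_Diff_subset[OF finite_subset[OF fin(2,1)] fin(2)] card_mono[OF fin] card_leaf_star(2)
    by simp
qed

text \<open>Otherwise the three edges at \<open>v\<close> and their partners under \<open>s1\<close> form a closed set of at
  most six edges.\<close>

lemma bridge_leaving:
  assumes v: "v \<in> black D" "degree D v = 3"
  shows "\<exists>e\<in>bridges. \<beta> e = v \<and> \<beta> (s1 e) \<noteq> v"
proof (rule ccontr)
  assume none: "\<not> ?thesis"
  define Star where "Star = {e \<in> edges D. \<beta> e = v}"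
  have Star_card: "card Star = 3" "finite Star"
    using v incident_black[OF dessin v(1)] finite_sets by (auto simp: Star_def degree_def)
  have Star_sub: "Star \<subseteq> star_edges" using v by (auto simp: Star_def star_edges_def)
  have sub: "Star \<union> s1 ` Star \<subseteq> edges D" by (auto simp: Star_def)
  have s0_closed: "s0 (s1 e) \<in> Star \<union> s1 ` Star" if e: "e \<in> Star" for e
  proof (cases "e \<in> bridges")
    case True
    then have "\<beta> (s1 e) = v" using none e by (auto simp: Star_def)
    then have "s0 (s1 e) \<in> Star" using e by (simp add: Star_def)
    then show ?thesis by blast
  next
    case False
    then have "s1 e \<in> leaf_edges" using star_not_bridge Star_sub e by auto
    then show ?thesis using s0_leaf e by auto
  qed
  have "card (Star \<union> s1 ` Star) = 14"
  proof (rule closed_subset_card[OF sub])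
    show "Star \<union> s1 ` Star \<noteq> {}" using Star_card by auto
    show "s0 e \<in> Star \<union> s1 ` Star" if "e \<in> Star \<union> s1 ` Star" for e
    proof -
      from that consider "e \<in> Star" | y where "y \<in> Star" "e = s1 y" by blast
      then show ?thesis
      proof cases
        case 1
        then have "s0 e \<in> Star" by (simp add: Star_def)
        then show ?thesis by blast
      next
        case 2
        then show ?thesis using s0_closed by simp
      qed
    qed
    show "s1 e \<in> Star \<union> s1 ` Star" if "e \<in> Star \<union> s1 ` Star" for e
      using that by (auto simp: Star_def)
  qed
  moreover have "card (Star \<union> s1 ` Star) \<le> 6"
    using card_Un_le[of Star "s1 ` Star"] card_image_le[OF Star_card(2), of s1] Star_card(1) by simp
  ultimately show False by simp
qed

lemma bridge_ends:
  assumes "e \<in> bridges"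
  shows "e \<in> edges D" "s1 e \<in> bridges" "\<beta> e \<in> black D" "degree D (\<beta> e) = 3"
  using assms dessin_ends(1)[OF dessin] by (auto simp: bridges_def star_edges_def)

text \<open>The bridges connect the three trivalent vertices along a path, with middle vertex
  \<open>\<beta> (s1 x) = \<beta> (s1 z)\<close>.\<close>

lemma bridges_to_common_vertex:
  obtains x z where "x \<in> bridges" "z \<in> bridges" "\<beta> x \<noteq> \<beta> z" "\<beta> (s1 x) = \<beta> (s1 z)"
    "\<beta> x \<noteq> \<beta> (s1 x)" "\<beta> z \<noteq> \<beta> (s1 z)"
proof -
  define B where "B = {v \<in> black D. degree D v = 3}"
  have card_B: "card B = 3" "finite B" using card_degree finite_sets by (auto simp: B_def)
  have B_end: "\<beta> e \<in> B" if "e \<in> bridges" for e using bridge_ends[OF that] by (simp add: B_def)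
  have "B \<noteq> {}" using card_B by force
  then obtain p where p: "p \<in> B" by blast
  obtain x where x: "x \<in> bridges" "\<beta> x = p" "\<beta> (s1 x) \<noteq> p"
    using bridge_leaving[of p] p by (auto simp: B_def)
  let ?q = "\<beta> (s1 x)"
  have q: "?q \<in> B" using B_end bridge_ends(2)[OF x(1)] by simp
  have "card (B - {p, ?q}) = 1"
    using card_Diff_subset[of "{p, ?q}" B] card_B p q x(3) by simp
  then obtain r where r: "B - {p, ?q} = {r}" using card_1_singletonE by blast
  then have rB: "r \<in> B" "r \<noteq> p" "r \<noteq> ?q" by blast+
  then obtain z where z: "z \<in> bridges" "\<beta> z = r" "\<beta> (s1 z) \<noteq> r"
    using bridge_leaving[of r] by (auto simp: B_def)
  have "\<beta> (s1 z) \<in> B" using B_end bridge_ends(2)[OF z(1)] by simp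
  then consider "\<beta> (s1 z) = ?q" | "\<beta> (s1 z) = p" using z(3) r by blast
  then show thesis
  proof cases
    case 1
    show thesis by (rule that[of x z]) (use 1 x z rB in simp_all)
  next
    case 2
    show thesis by (rule that[of "s1 x" z]) (use 2 x z rB bridge_ends(1,2)[OF x(1)] in auto)
  qed
qed

text \<open>Since the middle vertex has degree three, one of the two edges leading to the outer vertices follows
  the other one in the cyclic order; this fixes which outer vertex is called the first.\<close>

lemma oriented_bridges:
  obtains x z where "x \<in> bridges" "z \<in> bridges" "\<beta> x \<noteq> \<beta> z" "s0 (s1 x) = s1 z"
    "\<beta> x \<noteq> \<beta> (s1 x)" "\<beta> z \<noteq> \<beta> (s1 x)"
proof -
  obtain x z where xz: "x \<in> bridges" "z \<in> bridges" "\<beta> x \<noteq> \<beta> z" "\<beta> (s1 x) = \<beta> (s1 z)"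
    "\<beta> x \<noteq> \<beta> (s1 x)" "\<beta> z \<noteq> \<beta> (s1 z)"
    by (rule bridges_to_common_vertex)
  note ex = bridge_ends[OF xz(1)] and ez = bridge_ends[OF xz(2)]
  have st: "s1 x \<in> star_edges" using xz(1) by (simp add: bridges_def)
  have "s1 z \<in> {y \<in> edges D. \<beta> y = \<beta> (s1 x)}" using xz(4) ez(1) by simp
  then have "s1 z \<in> {s1 x, s0 (s1 x), s0 (s0 (s1 x))}" by (simp only: star(1)[OF st])
  moreover have "s1 z \<noteq> s1 x" using xz(3) inj_onD[OF s1_inj, of z x] ex(1) ez(1) by blast
  ultimately consider "s0 (s1 x) = s1 z" | "s0 (s0 (s1 x)) = s1 z" by (metis insertE singletonD)
  then show thesis
  proof cases
    case 1
    show thesis by (rule that[of x z]) (use 1 xz in simp_all)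
  next
    case 2
    then have "s0 (s1 z) = s1 x" using star(2)[OF st] by simp
    then show thesis by (intro that[of z x]) (use xz in simp_all)
  qed
qed

text \<open>Numbers 1 to 3 and 4 to 6 go around the two outer trivalent vertices, starting with the bridges \<open>x\<close>
  and \<open>z\<close>; number 7 is the edge at the black leaf attached to the middle vertex; and \<open>i + 7\<close> is the
  \<open>s1\<close>-partner of \<open>i\<close>.\<close>

lemma normal_form:
  obtains g where "bij_betw g {1..14} (edges D)"
    "\<And>i. i \<in> {1..14} \<Longrightarrow> g (blocks 7 perm_a perm_b i) = s0 (g i)"
    "\<And>i. i \<in> {1..14} \<Longrightarrow> g (flip 7 i) = s1 (g i)"
proof -
  obtain x z where xz: "x \<in> bridges" "z \<in> bridges" "\<beta> x \<noteq> \<beta> z" "s0 (s1 x) = s1 z"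
    "\<beta> x \<noteq> \<beta> (s1 x)" "\<beta> z \<noteq> \<beta> (s1 x)"
    by (rule oriented_bridges)
  note ex = bridge_ends[OF xz(1)] and ez = bridge_ends[OF xz(2)]
  have bx: "\<beta> (s1 z) = \<beta> (s1 x)" using xz(4) ex by (metis s0_edge(2) s1_edge(1))
  have st: "x \<in> star_edges" "z \<in> star_edges" "s1 x \<in> star_edges"
    using xz(1,2) by (simp_all add: bridges_def)
  have dist: "distinct [x, z, s1 x, s1 z]"
    using xz bx ex ez by (auto dest: inj_onD[OF s1_inj])
  have bridges: "bridges = {x, z, s1 x, s1 z}"
  proof (rule card_subset_eq[symmetric])
    show "finite bridges" using finite_sets by (auto simp: bridges_def star_edges_def)
    show "{x, z, s1 x, s1 z} \<subseteq> bridges" using xz(1,2) ex(2) ez(2) by simp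
    show "card {x, z, s1 x, s1 z} = card bridges" using dist card_bridges by simp
  qed
  let ?u = "s0 (s1 z)"
  have other: "s0 (s1 e) = s1 e" "e \<in> edges D" if "e \<in> star_edges" "e \<notin> bridges" for e
    using s0_leaf[OF star_not_bridge[OF that]] star(4)[OF that(1)] by auto
  have star_x: "e \<notin> bridges" if "\<beta> e = \<beta> x" "e \<noteq> x" for e
    unfolding bridges using that xz(3,5) bx by auto
  have star_z: "e \<notin> bridges" if "\<beta> e = \<beta> z" "e \<noteq> z" for e
    unfolding bridges using that xz(3,6) bx by auto
  have star_m: "e \<notin> bridges" if "\<beta> e = \<beta> (s1 x)" "e \<noteq> s1 x" "e \<noteq> s1 z" for e
    unfolding bridges using that xz(5,6) by auto
  note d = star(3)[OF st(1)] star(3)[OF st(2)] star(3)[OF st(3), unfolded xz(4)]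
  have nb: "s0 x \<notin> bridges" "s0 (s0 x) \<notin> bridges"
    by (rule star_x; use d(1) ex(1) in auto)+
  have nb': "s0 z \<notin> bridges" "s0 (s0 z) \<notin> bridges"
    by (rule star_z; use d(2) ez(1) in auto)+
  have nb'': "?u \<notin> bridges"
    by (rule star_m; use d(3) ez(1) bx in auto)
  note leaves = other[OF star(5)[OF st(1)] nb(1)] other[OF star(6)[OF st(1)] nb(2)]
    other[OF star(5)[OF st(2)] nb'(1)] other[OF star(6)[OF st(2)] nb'(2)]
    other[OF star(6)[OF st(3), unfolded xz(4)] nb'']
  note cyc = star(2)[OF st(1)] star(2)[OF st(2)] star(2)[OF st(3), unfolded xz(4)]
  \<comment> \<open>the edge \<open>s0 (s1 z)\<close> is the third edge at the middle vertex\<close>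
  define half where "half = [x, s0 x, s0 (s0 x), z, s0 z, s0 (s0 z), s1 ?u]"
  define g where "g i = (half @ map s1 half) ! (i - 1)" for i
  have g_values: "g 1 = x" "g 2 = s0 x" "g 3 = s0 (s0 x)" "g 4 = z" "g 5 = s0 z" "g 6 = s0 (s0 z)"
    "g 7 = s1 ?u" "g 8 = s1 x" "g 9 = s1 (s0 x)" "g 10 = s1 (s0 (s0 x))" "g 11 = s1 z"
    "g 12 = s1 (s0 z)" "g 13 = s1 (s0 (s0 z))" "g 14 = ?u"
    using leaves by (simp_all add: g_def half_def)
  have g0: "g (blocks 7 perm_a perm_b i) = s0 (g i)" if "i \<in> {1..14}" for i
    using that unfolding one_to_fourteen
    by (elim insertE emptyE) (simp_all add: blocks_def perm_a_apply perm_b_apply g_values g_values(1)[unfolded One_nat_def]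
        leaves cyc xz(4))
  have g1: "g (flip 7 i) = s1 (g i)" if "i \<in> {1..14}" for i
    using that unfolding one_to_fourteen
    by (elim insertE emptyE) (simp_all add: flip_def g_values g_values(1)[unfolded One_nat_def] leaves ex ez)
  have gE: "g ` {1..14} \<subseteq> edges D"
    unfolding one_to_fourteen by (simp add: g_values g_values(1)[unfolded One_nat_def] leaves ex ez)
  have perm7: "perm_a permutes {1..7}" "perm_b permutes {1..7}"
    using perm_ab_alt by (auto simp: alt_group_carrier)
  \<comment> \<open>surjectivity, and thereby injectivity, follows from transitivity\<close>
  have "card (g ` {1..14}) = 14"
  proof (rule closed_subset_card[OF gE])
    show "s0 e \<in> g ` {1..14}" if "e \<in> g ` {1..14}" for e
    proof -
      from that obtain i where i: "i \<in> {1..14}" "e = g i" by blast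
      have "blocks 7 perm_a perm_b i \<in> {1..14}"
        using permutes_in_image[OF blocks_permutes[OF perm7], of i] i by simp
      then show ?thesis using g0[OF i(1)] i(2) by (metis imageI)
    qed
    show "s1 e \<in> g ` {1..14}" if "e \<in> g ` {1..14}" for e
    proof -
      from that obtain i where i: "i \<in> {1..14}" "e = g i" by blast
      have "flip 7 i \<in> {1..14}"
        using permutes_in_image[OF flip_permutes, of 7 i] i by simp
      then show ?thesis using g1[OF i(1)] i(2) by (metis imageI)
    qed
  qed simp
  then have "g ` {1..14} = edges D" "inj_on g {1..14}"
    using gE card_edges finite_sets by (simp_all add: card_subset_eq eq_card_imp_inj_on)
  then show thesis using that[of g] g0 g1 by (simp add: bij_betw_def)
qed

end

lemma standard_rotation_range:
  assumes "i \<in> {1..14}"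
  shows "blocks 7 perm_a perm_b i \<in> {1..14}" "flip 7 i \<in> {1..14}"
proof -
  have "perm_a permutes {1..7}" "perm_b permutes {1..7}"
    using perm_ab_alt by (simp_all add: alt_group_carrier)
  then show "blocks 7 perm_a perm_b i \<in> {1..14}" "flip 7 i \<in> {1..14}"
    using permutes_in_image[OF blocks_permutes[of perm_a 7 perm_b], of i]
      permutes_in_image[OF flip_permutes[of 7], of i] assms by simp_all
qed

lemma dessin_with_passport_unique:
  assumes "dessin_with_passport T" "dessin_with_passport T'"
  shows "dessin_isomorphic T T'"
proof -
  interpret T: dessin_with_passport T by fact
  interpret T': dessin_with_passport T' by fact
  obtain g where g: "bij_betw g {1..14} (edges T)"
    "\<And>i. i \<in> {1..14} \<Longrightarrow> g (blocks 7 perm_a perm_b i) = black_next T (g i)"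
    "\<And>i. i \<in> {1..14} \<Longrightarrow> g (flip 7 i) = white_next T (g i)"
    by (rule T.normal_form) blast
  obtain g' where g': "bij_betw g' {1..14} (edges T')"
    "\<And>i. i \<in> {1..14} \<Longrightarrow> g' (blocks 7 perm_a perm_b i) = black_next T' (g' i)"
    "\<And>i. i \<in> {1..14} \<Longrightarrow> g' (flip 7 i) = white_next T' (g' i)"
    by (rule T'.normal_form) blast
  define h where "h = g' \<circ> inv_into {1..14} g"
  have h_g: "h (g i) = g' i" if "i \<in> {1..14}" for i
    using inv_into_f_f[OF bij_betw_imp_inj_on[OF g(1)] that] by (simp add: h_def)
  have ex: "\<exists>i\<in>{1..14}. e = g i" if "e \<in> edges T" for e
    using that bij_betw_imp_surj_on[OF g(1)] by blast
  show ?thesis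
  proof (rule dessin_isomorphicI[OF T.dessin T'.dessin])
    show "passport T = passport T'" by (simp add: T.passport T'.passport)
    show "bij_betw h (edges T) (edges T')"
      unfolding h_def by (rule bij_betw_trans[OF bij_betw_inv_into[OF g(1)] g'(1)])
    show "h (black_next T e) = black_next T' (h e)" if e: "e \<in> edges T" for e
    proof -
      obtain i where i: "i \<in> {1..14}" "e = g i" using ex[OF e] by blast
      then show ?thesis
        using h_g[OF i(1)] h_g[OF standard_rotation_range(1)[OF i(1)]] g(2)[OF i(1)] g'(2)[OF i(1)] by simp
    qed
    show "h (white_next T e) = white_next T' (h e)" if e: "e \<in> edges T" for e
    proof -
      obtain i where i: "i \<in> {1..14}" "e = g i" using ex[OF e] by blast
      then show ?thesis
        using h_g[OF i(1)] h_g[OF standard_rotation_range(2)[OF i(1)]] g(3)[OF i(1)] g'(3)[OF i(1)] by simp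
    qed
  qed (fact T.degree_nonzero T'.degree_nonzero)+
qed

section \<open>A tree with the given passport\<close>

text \<open>The vertices are \<open>0, \<dots>, 14\<close> with root 0, the middle trivalent vertex; the edge \<open>e\<close> joins the
  vertex \<open>e\<close> to its parent, which is smaller than \<open>e\<close>.  The value at the root is irrelevant.\<close>

definition tree_parent :: "nat \<Rightarrow> nat" where
  "tree_parent e = [0, 0, 0, 0, 1, 2, 3, 4, 4, 5, 5, 7, 8, 9, 10] ! e"

text \<open>The vertices at even distance from the root.\<close>

definition tree_black :: "nat set" where
  "tree_black = {0, 4, 5, 6, 11, 12, 13, 14}"

text \<open>Vertices 1, 2, 3 are the midpoints around the root; they lead to the trivalent vertices 4, 5 and to
  the leaf 6.  The rotation around a vertex depends only on its color: the black one has the cycles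
  \<open>(1 2 3)\<close>, \<open>(4 7 8)\<close> and \<open>(5 9 10)\<close>, the white one exchanges the two edges at each midpoint.
  The list entry at index 0 is a dummy, since edges are numbered from 1.\<close>

definition example_tree :: "(nat, nat) dessin" where
  "example_tree = \<lparr>black = tree_black, white = {1, 2, 3, 7, 8, 9, 10}, edges = {1..14},
     black_end = (\<lambda>e. if e \<in> tree_black then e else tree_parent e),
     white_end = (\<lambda>e. if e \<in> tree_black then tree_parent e else e),
     rot = (\<lambda>v e. if v \<in> tree_black
       then [0, 2, 3, 1, 7, 9, 6, 8, 4, 10, 5, 11, 12, 13, 14] ! e
       else [0, 4, 5, 6, 1, 2, 3, 11, 12, 13, 14, 7, 8, 9, 10] ! e)\<rparr>"

lemma tree_sets:
  "black example_tree = tree_black" "white example_tree = {1, 2, 3, 7, 8, 9, 10}"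
  "edges example_tree = {1, 2, 3, 4, 5, 6, 7, 8, 9, 10, 11, 12, 13, 14}"
  "verts example_tree = {0, 1, 2, 3, 4, 5, 6, 7, 8, 9, 10, 11, 12, 13, 14}"
  by (simp_all only: verts_def example_tree_def dessin.simps one_to_fourteen tree_black_def) auto

lemma tree_ends: "e \<in> edges example_tree \<Longrightarrow> ends example_tree e = {e, tree_parent e}"
  by (auto simp: example_tree_def ends_def)

lemma tree_parent_less: "e \<in> edges example_tree \<Longrightarrow> tree_parent e < e"
  unfolding tree_sets by (elim insertE emptyE) (simp_all add: tree_parent_def)

lemma tree_incident:
  "incident example_tree 0 = {1, 2, 3}" "incident example_tree 1 = {1, 4}"
  "incident example_tree 2 = {2, 5}" "incident example_tree 3 = {3, 6}"
  "incident example_tree 4 = {4, 7, 8}" "incident example_tree 5 = {5, 9, 10}"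
  "incident example_tree 6 = {6}" "incident example_tree 7 = {7, 11}"
  "incident example_tree 8 = {8, 12}" "incident example_tree 9 = {9, 13}"
  "incident example_tree 10 = {10, 14}" "incident example_tree 11 = {11}"
  "incident example_tree 12 = {12}" "incident example_tree 13 = {13}"
  "incident example_tree 14 = {14}"
proof -
  have inc: "incident example_tree v = {e \<in> edges example_tree. e = v \<or> tree_parent e = v}" for v
    using tree_ends by (auto simp: incident_def)
  have edges: "edges example_tree = set [1, 2, 3, 4, 5, 6, 7, 8, 9, 10, 11, 12, 13, 14]"
    by (simp add: tree_sets)
  show "incident example_tree 0 = {1, 2, 3}" "incident example_tree 1 = {1, 4}"
    "incident example_tree 2 = {2, 5}" "incident example_tree 3 = {3, 6}"
    "incident example_tree 4 = {4, 7, 8}" "incident example_tree 5 = {5, 9, 10}"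
    "incident example_tree 6 = {6}" "incident example_tree 7 = {7, 11}"
    "incident example_tree 8 = {8, 12}" "incident example_tree 9 = {9, 13}"
    "incident example_tree 10 = {10, 14}" "incident example_tree 11 = {11}"
    "incident example_tree 12 = {12}" "incident example_tree 13 = {13}"
    "incident example_tree 14 = {14}"
    unfolding inc edges set_filter[symmetric] by (simp_all add: tree_parent_def)
qed

lemma orbit_subset_closed:
  assumes "f x \<in> S" "\<And>z. z \<in> S \<Longrightarrow> f z \<in> S"
  shows "orbit f x \<subseteq> S"
proof
  fix y assume "y \<in> orbit f x"
  then show "y \<in> S" by induction (fact assms(1), rule assms(2))
qed

lemma cyclic_on_1:
  assumes "f x = x"
  shows "cyclic_on f {x}"
proof (rule cyclic_on_singleI[of x])
  have "x \<in> orbit f x" using orbit.base[of f x] unfolding assms .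
  moreover have "orbit f x \<subseteq> {x}" using assms by (intro orbit_subset_closed) simp_all
  ultimately show "{x} = orbit f x" by blast
qed simp

lemma cyclic_on_2:
  assumes "f x = y" "f y = x"
  shows "cyclic_on f {x, y}"
proof (rule cyclic_on_singleI[of x])
  have y: "y \<in> orbit f x" using orbit.base[of f x] unfolding assms(1) .
  have "x \<in> orbit f x" using orbit.step[OF y] unfolding assms(2) .
  moreover have "orbit f x \<subseteq> {x, y}" using assms by (intro orbit_subset_closed) auto
  ultimately show "{x, y} = orbit f x" using y by blast
qed simp

lemma cyclic_on_3:
  assumes "f x = y" "f y = z" "f z = x"
  shows "cyclic_on f {x, y, z}"
proof (rule cyclic_on_singleI[of x])
  have y: "y \<in> orbit f x" using orbit.base[of f x] unfolding assms(1) .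
  have z: "z \<in> orbit f x" using orbit.step[OF y] unfolding assms(2) .
  have "x \<in> orbit f x" using orbit.step[OF z] unfolding assms(3) .
  moreover have "orbit f x \<subseteq> {x, y, z}"
    by (rule orbit_subset_closed) (use assms(1) in simp, elim insertE emptyE, simp_all add: assms)
  ultimately show "{x, y, z} = orbit f x" using y z by blast
qed simp

lemma example_tree_connected: "connected_graph example_tree"
proof -
  have sym: "sym (adj example_tree)" by (auto simp: sym_def adj_def insert_commute)
  have root: "v \<le> 14 \<Longrightarrow> (v, 0) \<in> (adj example_tree)\<^sup>*" for v
  proof (induction v rule: less_induct)
    case (less v)
    show ?case
    proof (cases "v = 0")
      case False
      then have v: "v \<in> edges example_tree" using less.prems by (auto simp: example_tree_def)
      then have "(v, tree_parent v) \<in> adj example_tree"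
        using tree_ends[OF v] by (auto simp: adj_def)
      then show ?thesis
        using less.IH[of "tree_parent v"] tree_parent_less[OF v] less.prems
        by (simp add: converse_rtrancl_into_rtrancl)
    qed simp
  qed
  have "(u, v) \<in> (adj example_tree)\<^sup>*" if "u \<in> verts example_tree" "v \<in> verts example_tree" for u v
  proof -
    have "u \<le> 14" "v \<le> 14" using that unfolding tree_sets by auto
    then show ?thesis
      using root[of u] symD[OF sym_rtrancl[OF sym] root[of v]] by (auto intro: rtrancl_trans)
  qed
  then show ?thesis by (auto simp: connected_graph_def tree_sets)
qed

lemma example_tree_dessin: "is_dessin example_tree"
proof -
  have ends_ok: "black_end example_tree e \<in> black example_tree \<and> white_end example_tree e \<in> white example_tree"
    if "e \<in> edges example_tree" for e
    using that unfolding tree_sets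
    by (elim insertE emptyE) (simp_all add: example_tree_def tree_black_def tree_parent_def)
  have cyc: "cyclic_on (rot example_tree v) (incident example_tree v)" if "v \<in> verts example_tree" for v
    using that unfolding tree_sets
    by (elim insertE emptyE)
      (simp_all only: tree_incident,
       (rule cyclic_on_1 cyclic_on_2 cyclic_on_3; simp add: example_tree_def tree_black_def)+)
  have "black example_tree \<inter> white example_tree = {}" "finite (verts example_tree)" "finite (edges example_tree)"
    by (simp_all add: tree_sets tree_black_def)
  then show ?thesis
    unfolding is_dessin_def using ends_ok cyc example_tree_connected by blast
qed

text \<open>On a cycle, both cycle edges at the largest vertex would be equal to the edge from that vertex to its
  parent.\<close>

lemma no_cycle_if_ends_descend:
  fixes D :: "(nat, nat) dessin"
  assumes ends: "\<And>e. e \<in> edges D \<Longrightarrow> ends D e = {e, par e}" "\<And>e. e \<in> edges D \<Longrightarrow> par e < e"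
  shows "\<not> graph_cycle D vs es"
proof
  assume c: "graph_cycle D vs es"
  define n where "n = length es"
  have n: "2 \<le> n" "length vs = n" "distinct es" "set es \<subseteq> edges D"
    and inc: "\<And>i. i < n \<Longrightarrow> ends D (es ! i) = {vs ! i, vs ! (Suc i mod n)}"
    using c by (auto simp: graph_cycle_def n_def)
  have vs_le: "vs ! i \<le> Max (set vs)" if "i < n" for i
    using that n by (intro Max_ge) auto
  have "vs \<noteq> []" using n by auto
  then have "Max (set vs) \<in> set vs" by (intro Max_in) auto
  then obtain j where j: "j < n" "vs ! j = Max (set vs)" using n by (auto simp: in_set_conv_nth)
  have top: "es ! i = Max (set vs)" if i: "i < n" "Max (set vs) \<in> ends D (es ! i)" for i
  proof -
    have e: "es ! i \<in> edges D" using n i(1) unfolding n_def by (meson nth_mem subset_iff)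
    have "Suc i mod n < n" using n by simp
    then have "x \<le> Max (set vs)" if "x \<in> ends D (es ! i)" for x
      using that inc[OF i(1)] vs_le i(1) by auto
    then show ?thesis using i(2) ends(1)[OF e] ends(2)[OF e] by fastforce
  qed
  define k where "k = (if j = 0 then n - 1 else j - 1)"
  have k: "k < n" "k \<noteq> j" "Suc k mod n = j" using j n by (auto simp: k_def)
  have "es ! j = es ! k"
    using top[of j] top[of k] inc[OF j(1)] inc[OF k(1)] j k by simp
  then show False using n(3) j(1) k(1,2) by (simp add: nth_eq_iff_index_eq n_def)
qed

lemma example_tree_tree: "is_tree_dessin example_tree"
  unfolding is_tree_dessin_def
  using example_tree_dessin no_cycle_if_ends_descend[OF tree_ends tree_parent_less] by blast

lemma example_tree_passport:
  "passport example_tree = (replicate_mset 3 3 + replicate_mset 5 1, replicate_mset 7 2)"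
proof -
  have copies: "replicate_mset 3 d = {#d, d, d#}" "replicate_mset 5 d = {#d, d, d, d, d#}"
    "replicate_mset 7 d = {#d, d, d, d, d, d, d#}" for d :: nat
    by (simp_all add: numeral_eq_Suc)
  show ?thesis
    unfolding copies
    by (simp add: passport_def tree_sets tree_black_def degree_def tree_incident
        tree_incident(2)[unfolded One_nat_def]) (simp add: numeral_2_eq_2 numeral_3_eq_3)
qed

section \<open>The monodromy group\<close>

text \<open>The numbering of the normal form and the given labeling differ by a permutation \<open>\<psi>\<close> of
  \<open>{1..14}\<close>.  So the monodromy group is the image of the wreath product under its action on 14 points
  followed by conjugation with \<open>\<psi>\<close>.\<close>

lemma dessin_with_passport_monodromy_group:
  assumes "dessin_with_passport T" and lab: "edge_labeling T lab"
  shows "monodromy_group T lab \<cong> wreath_Z2 (alt_group 7)"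
proof -
  interpret T: dessin_with_passport T by fact
  obtain g where g: "bij_betw g {1..14} (edges T)"
    "\<And>i. i \<in> {1..14} \<Longrightarrow> g (blocks 7 perm_a perm_b i) = black_next T (g i)"
    "\<And>i. i \<in> {1..14} \<Longrightarrow> g (flip 7 i) = white_next T (g i)"
    by (rule T.normal_form) blast
  have lab14: "bij_betw lab (edges T) {1..14}"
    using lab by (simp add: edge_labeling_def T.card_edges)
  define \<psi> where "\<psi> i = (if i \<in> {1..14} then lab (g i) else i)" for i
  have "bij_betw (lab \<circ> g) {1..14} {1..14}" by (rule bij_betw_trans[OF g(1) lab14])
  then have "bij_betw \<psi> {1..14} {1..14}"
    by (subst bij_betw_cong[of _ _ "lab \<circ> g"]) (simp_all add: \<psi>_def)
  then have \<psi>: "\<psi> permutes {1..14}"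
    by (rule bij_imp_permutes) (auto simp: \<psi>_def)
  define conj where "conj p = \<psi> \<circ> p \<circ> inv' \<psi>" for p
  interpret C: group_hom "sym_group 14" "sym_group 14" conj
    unfolding conj_def[abs_def] by (rule sym_group_conj(1)[OF \<psi>])
  let ?W = "wreath_Z2 (alt_group 7)"
  interpret E: group_hom ?W "sym_group 14" "wreath_perm 7"
    using wreath_perm_hom[of 7] by simp
  define \<Theta> where "\<Theta> = conj \<circ> wreath_perm 7"
  interpret Th: group_hom ?W "sym_group 14" \<Theta>
    unfolding \<Theta>_def
    by (intro group_hom.intro group_hom_axioms.intro hom_compose[OF E.homh C.homh] group_wreath_Z2 alt_group_is_group sym_group_is_group)
  have inj: "inj_on \<Theta> (carrier ?W)"
    unfolding \<Theta>_def conj_def[abs_def]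
    by (intro comp_inj_on wreath_perm_inj inj_on_subset[OF sym_group_conj(2)[OF \<psi>]]) simp_all
  have conj_eqI: "f = conj p"
    if "\<And>j. j \<in> {1..14} \<Longrightarrow> f (\<psi> j) = \<psi> (p j)" "\<And>i. i \<notin> {1..14} \<Longrightarrow> f i = i" "p permutes {1..14}" for f p
  proof
    fix i
    show "f i = conj p i"
    proof (cases "i \<in> {1..14}")
      case True
      then have "inv' \<psi> i \<in> {1..14}" using permutes_in_image[OF permutes_inv[OF \<psi>]] by blast
      then show ?thesis using that(1)[of "inv' \<psi> i"] permutes_inverses(1)[OF \<psi>] by (simp add: conj_def)
    next
      case False
      then show ?thesis
        using that(2)[OF False] permutes_not_in[OF that(3) False] permutes_not_in[OF \<psi> False]
          permutes_not_in[OF permutes_inv[OF \<psi>] False] by (simp add: conj_def)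
    qed
  qed
  have lab_inv: "inv_into (edges T) lab (\<psi> j) = g j" "\<psi> j \<in> {1..14}" if "j \<in> {1..14}" for j
    using that inv_into_f_f[OF bij_betw_imp_inj_on[OF lab14]] bij_betwE[OF g(1)] bij_betwE[OF lab14]
    by (auto simp: \<psi>_def)
  have ab7: "perm_a permutes {1..7}" "perm_b permutes {1..7}"
    using perm_ab_alt by (simp_all add: alt_group_carrier)
  have s0: "sigma0 T lab = conj (blocks 7 perm_a perm_b)"
  proof (rule conj_eqI)
    fix j :: nat assume j: "j \<in> {1..14}"
    have "sigma0 T lab (\<psi> j) = lab (black_next T (g j))"
      using lab_inv[OF j] by (simp add: sigma0_def T.card_edges black_next_def Let_def)
    also have "\<dots> = \<psi> (blocks 7 perm_a perm_b j)"
      using g(2)[OF j] standard_rotation_range(1)[OF j] by (simp add: \<psi>_def)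
    finally show "sigma0 T lab (\<psi> j) = \<psi> (blocks 7 perm_a perm_b j)" .
  next
    show "blocks 7 perm_a perm_b permutes {1..14}" using blocks_permutes[OF ab7] by simp
  qed (auto simp: sigma0_def T.card_edges)
  have s1: "sigma1 T lab = conj (flip 7)"
  proof (rule conj_eqI)
    fix j :: nat assume j: "j \<in> {1..14}"
    have "sigma1 T lab (\<psi> j) = lab (white_next T (g j))"
      using lab_inv[OF j] by (simp add: sigma1_def T.card_edges white_next_def Let_def)
    also have "\<dots> = \<psi> (flip 7 j)"
      using g(3)[OF j] standard_rotation_range(2)[OF j] by (simp add: \<psi>_def)
    finally show "sigma1 T lab (\<psi> j) = \<psi> (flip 7 j)" .
  next
    show "flip 7 permutes {1..14}" using flip_permutes[of 7] by simp
  qed (auto simp: sigma1_def T.card_edges)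
  let ?gens = "{((perm_a, perm_b), 0), ((id, id), 1)}"
  have "id \<in> carrier (alt_group 7)" by (simp add: alt_group_carrier permutes_id)
  then have gens: "?gens \<subseteq> carrier ?W"
    using perm_ab_alt by (simp add: wreath_Z2_simps)
  have "\<Theta> ` ?gens = {sigma0 T lab, sigma1 T lab}"
    by (simp add: \<Theta>_def wreath_perm_def blocks_id s0 s1)
  then have carrier: "carrier (monodromy_group T lab) = \<Theta> ` carrier ?W"
    using Th.generate_img[OF gens] by (simp add: monodromy_group_def T.card_edges wreath_A7_generated)
  have "mult (monodromy_group T lab) = mult (sym_group 14)"
    by (simp add: monodromy_group_def T.card_edges)
  then have "\<Theta> \<in> hom ?W (monodromy_group T lab)"
    using Th.hom_mult by (intro homI) (simp_all add: carrier)
  then have "\<Theta> \<in> iso ?W (monodromy_group T lab)"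
    unfolding iso_iff using inj carrier by simp
  then show ?thesis
    using group.iso_sym[OF group_wreath_Z2[OF alt_group_is_group] is_isoI] by blast
qed

theorem proposition10:
  defines "P \<equiv> (replicate_mset 3 3 + replicate_mset 5 1, replicate_mset 7 2)"
  shows "(\<exists>T :: (nat, nat) dessin. is_tree_dessin T \<and> passport T = P) \<and>
         (\<forall>(T :: ('v, 'e) dessin) (T' :: ('w, 'f) dessin).
            is_tree_dessin T \<and> passport T = P \<and> is_tree_dessin T' \<and> passport T' = P
            \<longrightarrow> dessin_isomorphic T T') \<and>
         (\<forall>(T :: ('v, 'e) dessin) lab.
            is_tree_dessin T \<and> passport T = P \<and> edge_labeling T lab
            \<longrightarrow> monodromy_group T lab \<cong> wreath_Z2 (alt_group 7))"
proof (intro conjI allI impI)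
  show "\<exists>T :: (nat, nat) dessin. is_tree_dessin T \<and> passport T = P"
    using example_tree_tree example_tree_passport by (auto simp: P_def)
next
  fix T :: "('v, 'e) dessin" and T' :: "('w, 'f) dessin"
  assume "is_tree_dessin T \<and> passport T = P \<and> is_tree_dessin T' \<and> passport T' = P"
  then show "dessin_isomorphic T T'"
    by (intro dessin_with_passport_unique dessin_with_passport.intro) (simp_all add: P_def is_tree_dessin_def)
next
  fix T :: "('v, 'e) dessin" and lab
  assume "is_tree_dessin T \<and> passport T = P \<and> edge_labeling T lab"
  then show "monodromy_group T lab \<cong> wreath_Z2 (alt_group 7)"
    by (intro dessin_with_passport_monodromy_group dessin_with_passport.intro) (simp_all add: P_def is_tree_dessin_def)
qed

end
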